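(* Let $n\ge1$ be an integer, let $\beta\ge 1$, $a>1$, $b>1$, and put $\theta=\frac{\beta}{2}$. Let $\mathcal{M}^{Jac,N}_{p,q,\beta}$ denote the $N$-particle $\beta$-Jacobi ensemble with parameters $p,q$ and let $\Lambda^{\theta}_{n,n+1}$ be the Dixon–Anderson Markov kernel from $W^{n+1}([0,1])$ to $W^{n}([0,1])$ (both defined in the context). Then $$\mathcal{M}^{Jac,n+1}_{a-1,b-1,\beta}\,\Lambda^{\theta}_{n,n+1}=\mathcal{M}^{Jac,n}_{a,b,\beta}.$$
   Context: For $N\ge1$, let $W^N([0,1])=\{x=(x_1,\dots,x_N)\in[0,1]^N: x_1\le\cdots\le x_N\}$. $\beta$-Jacobi ensemble. For $N\ge1$, $\beta\ge 1$ and $p,q>0$, $\mathcal{M}^{Jac,N}_{p,q,\beta}$ is the probability measure on $W^N([0,1])$ $$\mathcal{M}^{Jac,N}_{p,q,\beta}(dx)=C_{N,p,q,\beta}^{-1}\prod_{i=1}^{N}x_i^{\frac{\beta}{2}p-1}(1-x_i)^{\frac{\beta}{2}q-1}\prod_{1\le i<j\le N}|x_j-x_i|^{\beta}\,dx,$$ where $C_{N,p,q,\beta}$ is the normalization constant. Dixon–Anderson kernel. For $x\in W^{n+1}([0,1])$ let $$W^{n,n+1}(x)=\{y=(y_1,\dots,y_n)\in [0,1]^n: x_1\le y_1\le x_2\le\cdots\le y_n\le x_{n+1}\}.$$ For $x$ with strictly increasing coordinates (which is almost every $x$ for the ensemble above), the following is a probability density in $y$ on $W^{n,n+1}(x)$: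 $$\lambda^{\theta}_{n,n+1}(x,y)=\frac{\Gamma(\theta(n+1))}{\Gamma(\theta)^{n+1}}\prod_{1\le i<j\le n+1}(x_j-x_i)^{1-2\theta}\prod_{1\le i<j\le n}(y_j-y_i)\prod_{i=1}^{n}\prod_{j=1}^{n+1}|y_i-x_j|^{\theta-1},$$ and $\Lambda^{\theta}_{n,n+1}(x,dy)=\lambda^{\theta}_{n,n+1}(x,y)\mathbf{1}_{W^{n,n+1}(x)}(y)\,dy$. For a measure $\mu$ on $W^{n+1}([0,1])$, $\mu\Lambda^{\theta}_{n,n+1}$ is the measure on $W^n([0,1])$ given by $(\mu\Lambda^{\theta}_{n,n+1})(dy)=\int \mu(dx)\,\Lambda^{\theta}_{n,n+1}(x,dy)$. *)

theory Defs
  imports "HOL-Probability.Probability"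
begin

text \<open>
  A point \<open>x = (x\<^sub>1, \<dots>, x\<^sub>N)\<close> is a function \<open>x :: nat \<Rightarrow> real\<close> in
  the extensional function space over the index set \<open>{1..N}\<close>, so that \<open>N\<close> is an ordinary
  natural number and Lebesgue measure is a product measure.
\<close>

definition weyl :: "nat \<Rightarrow> (nat \<Rightarrow> real) set" where
  "weyl N = {x \<in> {1..N} \<rightarrow>\<^sub>E {0..1}. mono_on {1..N} x}"

definition weyl_lborel :: "nat \<Rightarrow> (nat \<Rightarrow> real) measure" where
  "weyl_lborel N = restrict_space (\<Pi>\<^sub>M i\<in>{1..N}. lborel) (weyl N)"

text \<open>
  Since \<open>0 powr s = 0\<close> for every \<open>s\<close>, the weights below take the value \<open>0\<close> (instead of
  being infinite or undefined, or \<open>1\<close> for exponent \<open>0\<close>) at points where a factor with a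
  nonpositive exponent has base \<open>0\<close>.  These points form Lebesgue null sets.
\<close>

definition jacobi_weight :: "nat \<Rightarrow> real \<Rightarrow> real \<Rightarrow> real \<Rightarrow> (nat \<Rightarrow> real) \<Rightarrow> real" where
  "jacobi_weight N p q \<beta> x =
     (\<Prod>i=1..N. x i powr (\<beta> / 2 * p - 1) * (1 - x i) powr (\<beta> / 2 * q - 1)) *
     (\<Prod>i=1..N. \<Prod>j\<in>{i<..N}. \<bar>x j - x i\<bar> powr \<beta>)"

definition jacobi_const :: "nat \<Rightarrow> real \<Rightarrow> real \<Rightarrow> real \<Rightarrow> ennreal" where
  "jacobi_const N p q \<beta> = (\<integral>\<^sup>+ x. ennreal (jacobi_weight N p q \<beta> x) \<partial>weyl_lborel N)"

definition jacobi_ensemble :: "nat \<Rightarrow> real \<Rightarrow> real \<Rightarrow> real \<Rightarrow> (nat \<Rightarrow> real) measure" where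
  "jacobi_ensemble N p q \<beta> =
     density (weyl_lborel N) (\<lambda>x. ennreal (jacobi_weight N p q \<beta> x) / jacobi_const N p q \<beta>)"

definition interlacing :: "nat \<Rightarrow> (nat \<Rightarrow> real) \<Rightarrow> (nat \<Rightarrow> real) set" where
  "interlacing n x = {y \<in> {1..n} \<rightarrow>\<^sub>E {0..1}. \<forall>i\<in>{1..n}. x i \<le> y i \<and> y i \<le> x (i + 1)}"

definition dixon_anderson_density :: "nat \<Rightarrow> real \<Rightarrow> (nat \<Rightarrow> real) \<Rightarrow> (nat \<Rightarrow> real) \<Rightarrow> real" where
  "dixon_anderson_density n \<theta> x y =
     Gamma (\<theta> * real (n + 1)) / Gamma \<theta> ^ (n + 1) *
     (\<Prod>i=1..n+1. \<Prod>j\<in>{i<..n+1}. (x j - x i) powr (1 - 2 * \<theta>)) *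
     (\<Prod>i=1..n. \<Prod>j\<in>{i<..n}. y j - y i) *
     (\<Prod>i=1..n. \<Prod>j=1..n+1. \<bar>y i - x j\<bar> powr (\<theta> - 1))"

text \<open>
  The kernel maps \<open>x \<in> weyl (n + 1)\<close> to a measure on \<open>weyl n\<close>.  It is a probability measure if
  the coordinates of \<open>x\<close> are strictly increasing.  If two coordinates of \<open>x\<close> coincide, which
  happens only on a null set, the density vanishes by the convention for \<open>0 powr s\<close> and the
  measure is the null measure; the kernel is therefore a subprobability kernel everywhere, as
  required for composing it with a measure by the Giry monad's bind.
\<close>

definition dixon_anderson :: "nat \<Rightarrow> real \<Rightarrow> (nat \<Rightarrow> real) \<Rightarrow> (nat \<Rightarrow> real) measure" where
  "dixon_anderson n \<theta> x =
     density (weyl_lborel n)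
       (\<lambda>y. ennreal (dixon_anderson_density n \<theta> x y) * indicator (interlacing n x) y)"

end

theory Submission
  imports Defs
begin

text \<open>
  Put \<open>\<theta> = \<beta> / 2\<close>.  When the Jacobi weight of \<open>n + 1\<close> particles \<open>x\<close> is multiplied by the density of
  the kernel, the powers \<open>2 * \<theta>\<close> and \<open>1 - 2 * \<theta>\<close> of the differences \<open>x\<^sub>j - x\<^sub>i\<close> combine to the first power.
  For fixed \<open>y\<close> the joint density is therefore a multiple of
  \[ \prod_{i<j} (x_j - x_i) \prod_i \prod_{j=0}^{n+1} |x_i - z_j|^{s_j - 1}, \]
  where \<open>z = (0, y\<^sub>1, \<dots>, y\<^sub>n, 1)\<close> and \<open>s = (\<theta>(a - 1), \<theta>, \<dots>, \<theta>, \<theta>(b - 1))\<close>, and the interlacing condition says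
  that each \<open>x\<^sub>i\<close> ranges over its own cell \<open>[z\<^sub>i\<^sub>-\<^sub>1, z\<^sub>i]\<close>.  Its integral over \<open>x\<close> is given by the
  Dixon-Anderson formula (\<open>dixon_anderson_integral\<close>): for nodes \<open>z\<^sub>0 < \<dots> < z\<^sub>m\<close> and exponents \<open>s\<^sub>j > 0\<close>,
  \[ \int \prod_{i<j} (x_j - x_i) \prod_{i=1}^m \prod_{j=0}^m |x_i - z_j|^{s_j - 1} dx
     = \frac{\prod_j \Gamma(s_j)}{\Gamma(\sum_j s_j)} \prod_{i<j} (z_j - z_i)^{s_i + s_j - 1}. \]
  The right-hand side contains \<open>y\<^sub>i\<close> with exponent \<open>\<theta>(a - 1) + \<theta> - 1 = \<theta>a - 1\<close>, likewise \<open>1 - y\<^sub>i\<close> with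
  exponent \<open>\<theta>b - 1\<close>, and \<open>y\<^sub>j - y\<^sub>i\<close> with exponent \<open>2 * \<theta> - 1\<close>, which the Vandermonde factor in the kernel
  raises to \<open>\<beta>\<close>: this is the Jacobi weight of \<open>n\<close> particles.  The same formula with nodes \<open>x\<close> and all
  exponents \<open>\<theta>\<close> shows that the kernel has mass one; integrating the joint density over both variables
  then relates the two normalization constants, and all the constants cancel.

  The Dixon-Anderson formula is proved here without a change of variables.  Write \<open>\<phi>\<close> for the weight
  \<open>\<Prod>\<^sub>j |t - z\<^sub>j|\<^bsup>s\<^sub>j - 1\<^esup>\<close>, \<open>F\<close> for the integral, and \<open>\<xi>(t)\<close> for the integral with the additional factor
  \<open>\<Prod>\<^sub>i (t - x\<^sub>i)\<close>, a polynomial of degree \<open>m\<close> with leading coefficient \<open>F\<close>.  On every cell \<open>\<xi>\<close> is orthogonal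
  to the constants with respect to \<open>\<phi>\<close>, because the integrand is antisymmetric under the exchange of \<open>t\<close>
  and \<open>x\<^sub>i\<close>.  So is \<open>\<Sum>\<^sub>k s\<^sub>k \<Prod>\<^sub>j\<^sub>\<noteq>\<^sub>k (t - z\<^sub>j)\<close>, because its product with \<open>\<phi>\<close> is the derivative of
  \<open>\<phi>(t) \<Prod>\<^sub>j (t - z\<^sub>j)\<close>, which vanishes at all the nodes.  A polynomial of degree less than \<open>m\<close> with this
  property has a zero in each of the \<open>m\<close> cells and vanishes; hence
  \[ \Big(\sum_j s_j\Big) \xi(t) = F \sum_k s_k \prod_{j \ne k} (t - z_j) \]
  (\<open>dixon_integral_charpoly\<close>).  At \<open>t = z\<^sub>m\<close> this is a recurrence for \<open>F\<close> in the last exponent, whose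
  monotone solutions are multiples of the Beta function (\<open>Beta_characterization\<close>).  Integrated against
  \<open>\<phi>\<close> from \<open>z\<^sub>m\<close> to a further node, it evaluates the integral with one more node of exponent 1.  The
  two together give the formula by induction on the number of nodes.
\<close>

section \<open>Integrals of products of powers of distances\<close>

text \<open>
  The odd antiderivative, up to the factor \<open>s\<close>, of \<open>\<bar>u\<bar> powr (s - 1)\<close>.  Its continuity at \<open>0\<close> lets the
  fundamental theorem of calculus run across a singularity of the integrand.
\<close>

definition signed_powr :: "real \<Rightarrow> real \<Rightarrow> real" where
  "signed_powr s u = u * \<bar>u\<bar> powr (s - 1)"

lemma signed_powr_conv_max:
  assumes "s > 0"
  shows "signed_powr s u = max u 0 powr s - max (- u) 0 powr s"
proof (cases "u = 0")
  case False
  have "\<bar>u\<bar> powr s = \<bar>u\<bar> * \<bar>u\<bar> powr (s - 1)"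
    using False by (simp add: powr_diff)
  then show ?thesis
    by (cases "u > 0") (auto simp: signed_powr_def max_def)
qed (simp add: signed_powr_def)

lemma continuous_on_signed_powr [continuous_intros]:
  assumes "s > 0" and "continuous_on A f"
  shows "continuous_on A (\<lambda>x. signed_powr s (f x))"
  unfolding signed_powr_conv_max[OF \<open>s > 0\<close>]
  using assms by (intro continuous_intros continuous_on_powr') auto

lemma has_field_derivative_signed_powr:
  assumes "s > 0" and "u \<noteq> 0"
  shows "(signed_powr s has_field_derivative s * \<bar>u\<bar> powr (s - 1)) (at u)"
proof (cases "u > 0")
  case True
  have "((\<lambda>u. u powr s) has_field_derivative s * \<bar>u\<bar> powr (s - 1)) (at u)"
    using True by (auto intro!: derivative_eq_intros)
  then show ?thesis
    by (rule has_field_derivative_transform_within_open[where S = "{0<..}"])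
      (use True assms in \<open>auto simp: signed_powr_conv_max max_def\<close>)
next
  case False
  have "((\<lambda>u. - ((- u) powr s)) has_field_derivative s * \<bar>u\<bar> powr (s - 1)) (at u)"
    using False assms by (auto intro!: derivative_eq_intros simp: powr_diff divide_simps)
  then show ?thesis
    by (rule has_field_derivative_transform_within_open[where S = "{..<0}"])
      (use False assms in \<open>auto simp: signed_powr_conv_max max_def\<close>)
qed

lemma integrable_lborel_if_nonneg_integrable_on:
  fixes f :: "real \<Rightarrow> real"
  assumes "f \<in> borel_measurable borel" and "\<And>x. f x \<ge> 0" and "f integrable_on {a..b}"
  shows "integrable lborel (\<lambda>x. indicator {a..b} x * f x)"
proof -
  have "f absolutely_integrable_on {a..b}"
    using assms by (subst absolutely_integrable_on_iff_nonneg) auto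
  then have "integrable lebesgue (\<lambda>x. indicator {a..b} x *\<^sub>R f x)"
    by (simp add: set_integrable_def)
  then show ?thesis
    using assms(1) by (subst (asm) integrable_completion) (auto)
qed

text \<open>
  Since the integrand is nonnegative, the existence of a continuous antiderivative already implies
  absolute integrability, wherever the singularity \<open>c\<close> lies.
\<close>

lemma integrable_powr_dist:
  fixes a b c s :: real
  assumes "s > 0"
  shows "integrable lborel (\<lambda>x. indicator {a..b} x * \<bar>x - c\<bar> powr (s - 1))"
proof (cases "a \<le> b")
  case True
  have "((\<lambda>x. \<bar>x - c\<bar> powr (s - 1)) has_integral signed_powr s (b - c) / s - signed_powr s (a - c) / s) {a..b}"
  proof (rule fundamental_theorem_of_calculus_interior_strong[where S = "{c}"])
    fix x assume "x \<in> {a<..<b} - {c}"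
    then have "(signed_powr s has_field_derivative s * \<bar>x - c\<bar> powr (s - 1)) (at (x - c))"
      by (intro has_field_derivative_signed_powr assms) auto
    then have "((\<lambda>x. signed_powr s (x - c)) has_field_derivative s * \<bar>x - c\<bar> powr (s - 1)) (at x)"
      by (simp add: DERIV_at_within_shift_lemma[of _ _ x "-c" UNIV, simplified, unfolded o_def] 
            DERIV_shift[of _ _ x "-c", simplified])
    then have "((\<lambda>x. signed_powr s (x - c) / s) has_field_derivative \<bar>x - c\<bar> powr (s - 1)) (at x)"
      using assms by (auto intro!: derivative_eq_intros)
    then show "((\<lambda>x. signed_powr s (x - c) / s) has_vector_derivative \<bar>x - c\<bar> powr (s - 1)) (at x)"
      by (simp add: has_real_derivative_iff_has_vector_derivative)
  qed (use True assms in \<open>auto intro!: continuous_intros\<close>)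
  then show ?thesis
    by (intro integrable_lborel_if_nonneg_integrable_on) (auto simp: integrable_on_def)
qed simp

lemma powr_le_endpoints:
  fixes u l r e :: real
  assumes "0 < l" "l \<le> u" "u \<le> r"
  shows "u powr e \<le> l powr e + r powr e"
proof (cases "e \<ge> 0")
  case True
  then have "u powr e \<le> r powr e" using assms by (intro powr_mono2) auto
  then show ?thesis by (simp add: add_increasing)
next
  case False
  then have "u powr e \<le> l powr e" using assms by (intro powr_mono2') auto
  then show ?thesis by (simp add: add_increasing2)
qed

text \<open>
  No point is close to both \<open>c\<close> and \<open>d\<close>, so one of the two factors is bounded.
\<close>

lemma powr_dist_mult_le:
  fixes a b c d p q :: real
  assumes "c \<noteq> d"
  obtains C where "C \<ge> 0" and
    "\<And>x. x \<in> {a..b} \<Longrightarrow>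
       \<bar>x - c\<bar> powr p * \<bar>x - d\<bar> powr q \<le> C * (\<bar>x - c\<bar> powr p + \<bar>x - d\<bar> powr q)"
proof -
  define l r where "l = \<bar>c - d\<bar> / 2" and "r = \<bar>a\<bar> + \<bar>b\<bar> + \<bar>c\<bar> + \<bar>d\<bar>"
  define C where "C = (l powr p + r powr p) + (l powr q + r powr q)"
  have C: "\<bar>x - c\<bar> powr p * \<bar>x - d\<bar> powr q \<le> C * (\<bar>x - c\<bar> powr p + \<bar>x - d\<bar> powr q)"
    if "x \<in> {a..b}" for x
  proof -
    have "l > 0" using assms by (simp add: l_def)
    consider "l \<le> \<bar>x - c\<bar>" | "l \<le> \<bar>x - d\<bar>"
      unfolding l_def by argo
    then show ?thesis
    proof cases
      case 1
      have "\<bar>x - c\<bar> powr p \<le> l powr p + r powr p"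
        by (rule powr_le_endpoints) (use 1 \<open>l > 0\<close> that in \<open>auto simp: r_def\<close>)
      also have "\<dots> \<le> C" by (simp add: C_def)
      finally have "\<bar>x - c\<bar> powr p * \<bar>x - d\<bar> powr q \<le> C * \<bar>x - d\<bar> powr q"
        by (intro mult_right_mono) auto
      moreover have "0 \<le> C * \<bar>x - c\<bar> powr p" by (simp add: C_def)
      ultimately show ?thesis
        by (simp add: distrib_left)
    next
      case 2
      have "\<bar>x - d\<bar> powr q \<le> l powr q + r powr q"
        by (rule powr_le_endpoints) (use 2 \<open>l > 0\<close> that in \<open>auto simp: r_def\<close>)
      also have "\<dots> \<le> C" by (simp add: C_def)
      finally have "\<bar>x - c\<bar> powr p * \<bar>x - d\<bar> powr q \<le> \<bar>x - c\<bar> powr p * C"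
        by (intro mult_left_mono) auto
      moreover have "0 \<le> C * \<bar>x - d\<bar> powr q" by (simp add: C_def)
      ultimately show ?thesis
        by (simp add: distrib_left mult.commute)
    qed
  qed
  show thesis by (rule that[OF _ C]) (auto simp: C_def)
qed

definition node_weight :: "nat \<Rightarrow> (nat \<Rightarrow> real) \<Rightarrow> (nat \<Rightarrow> real) \<Rightarrow> real \<Rightarrow> real" where
  "node_weight m z s t = (\<Prod>j\<le>m. \<bar>t - z j\<bar> powr (s j - 1))"

lemma node_weight_nonneg [simp]: "node_weight m z s t \<ge> 0"
  by (simp add: node_weight_def prod_nonneg)

lemma borel_measurable_node_weight [measurable]: "node_weight m z s \<in> borel_measurable borel"
  unfolding node_weight_def by measurable

text \<open>
  At any point at most one factor is large.  This reduces the integrability of a product of powers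
  at distinct nodes to that of the single factors.
\<close>

lemma prod_powr_dist_le:
  fixes a b :: real and z e :: "nat \<Rightarrow> real"
  assumes "finite J" and "inj_on z J"
  shows "\<exists>C\<ge>0. \<forall>x\<in>{a..b}. (\<Prod>j\<in>J. \<bar>x - z j\<bar> powr e j) \<le> C * (1 + (\<Sum>j\<in>J. \<bar>x - z j\<bar> powr e j))"
  using assms
proof (induction J rule: finite_induct)
  case empty
  show ?case by (intro exI[of _ 1]) auto
next
  case (insert k J)
  let ?p = "\<lambda>j x. \<bar>x - z j\<bar> powr e j"
  obtain C where C: "C \<ge> 0" "\<And>x. x \<in> {a..b} \<Longrightarrow> (\<Prod>j\<in>J. ?p j x) \<le> C * (1 + (\<Sum>j\<in>J. ?p j x))"
    using insert by auto
  have "\<exists>D\<ge>0. \<forall>x\<in>{a..b}. ?p k x * ?p j x \<le> D * (?p k x + ?p j x)" if "j \<in> J" for j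
  proof -
    have "z k \<noteq> z j" using insert that by auto
    then show ?thesis by (metis powr_dist_mult_le)
  qed
  then obtain D where D: "\<And>j. j \<in> J \<Longrightarrow> D j \<ge> 0"
    "\<And>j x. j \<in> J \<Longrightarrow> x \<in> {a..b} \<Longrightarrow> ?p k x * ?p j x \<le> D j * (?p k x + ?p j x)"
    by metis
  define E where "E = C * (1 + (\<Sum>j\<in>J. D j))"
  have E0: "E \<ge> 0" unfolding E_def using C D by (intro mult_nonneg_nonneg add_nonneg_nonneg sum_nonneg) auto
  have "(\<Prod>j\<in>insert k J. ?p j x) \<le> E * (1 + (\<Sum>j\<in>insert k J. ?p j x))" if x: "x \<in> {a..b}" for x
  proof -
    define T where "T = ?p k x + (\<Sum>j\<in>J. ?p j x)"
    have "(\<Prod>j\<in>insert k J. ?p j x) = ?p k x * (\<Prod>j\<in>J. ?p j x)"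
      using insert by simp
    also have "\<dots> \<le> ?p k x * (C * (1 + (\<Sum>j\<in>J. ?p j x)))"
      using C(2)[OF x] by (intro mult_left_mono) auto
    also have "\<dots> = C * (?p k x + (\<Sum>j\<in>J. ?p k x * ?p j x))"
      by (simp add: algebra_simps sum_distrib_left)
    also have "\<dots> \<le> C * (T + (\<Sum>j\<in>J. D j * T))"
    proof (intro mult_left_mono add_mono sum_mono)
      show "?p k x \<le> T" by (simp add: T_def sum_nonneg)
      fix j assume j: "j \<in> J"
      have "?p j x \<le> (\<Sum>j\<in>J. ?p j x)" using insert j by (intro member_le_sum) auto
      then have "D j * (?p k x + ?p j x) \<le> D j * T"
        using D(1)[OF j] by (intro mult_left_mono) (auto simp: T_def)
      then show "?p k x * ?p j x \<le> D j * T" using D(2)[OF j x] by linarith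
    qed (use C in auto)
    also have "\<dots> = E * T" by (simp add: E_def algebra_simps sum_distrib_left sum_distrib_right)
    also have "\<dots> \<le> E * (1 + T)" using E0 by (intro mult_left_mono) auto
    finally show ?thesis using insert by (simp add: T_def)
  qed
  then show ?case using E0 by blast
qed

lemma integrable_node_weight:
  assumes "inj_on z {..m}" and "\<And>j. j \<le> m \<Longrightarrow> s j > 0"
  shows "integrable lborel (\<lambda>t. indicator {a..b} t * node_weight m z s t)"
proof -
  obtain C where C: "C \<ge> 0" "\<And>x. x \<in> {a..b} \<Longrightarrow>
      (\<Prod>j\<in>{..m}. \<bar>x - z j\<bar> powr (s j - 1)) \<le> C * (1 + (\<Sum>j\<in>{..m}. \<bar>x - z j\<bar> powr (s j - 1)))"
    using prod_powr_dist_le[of "{..m}" z a b "\<lambda>j. s j - 1"] assms by auto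
  have int: "integrable lborel (\<lambda>t. C * (indicator {a..b} t + (\<Sum>j\<in>{..m}. indicator {a..b} t * \<bar>t - z j\<bar> powr (s j - 1))))"
    using assms(2)
    by (intro integrable_mult_right Bochner_Integration.integrable_add Bochner_Integration.integrable_sum
        integrable_powr_dist integrable_real_indicator) (simp_all add: emeasure_lborel_Icc_eq)
  show ?thesis
  proof (rule Bochner_Integration.integrable_bound[OF int])
    show "AE t in lborel. norm (indicator {a..b} t * node_weight m z s t) \<le>
       norm (C * (indicator {a..b} t + (\<Sum>j\<in>{..m}. indicator {a..b} t * \<bar>t - z j\<bar> powr (s j - 1))))"
      using C by (intro AE_I2) (auto simp: node_weight_def indicator_def abs_mult prod_nonneg
          abs_of_nonneg sum_nonneg simp flip: sum_distrib_left split: if_splits)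
  qed measurable
qed

lemma integrable_bounded_mult_cell:
  assumes "inj_on z {..m}" and "\<And>j. j \<le> m \<Longrightarrow> s j > 0" and "continuous_on UNIV g"
  shows "integrable lborel (\<lambda>t. indicator {a..b} t * node_weight m z s t * g t)"
proof -
  have "compact (g ` {a..b})"
    using assms by (intro compact_continuous_image) (auto intro: continuous_on_subset)
  then obtain B where B: "\<And>t. t \<in> {a..b} \<Longrightarrow> \<bar>g t\<bar> \<le> B"
    by (metis bounded_iff compact_imp_bounded image_eqI real_norm_def)
  have [measurable]: "g \<in> borel_measurable borel"
    using assms(3) by (rule borel_measurable_continuous_onI)
  show ?thesis
  proof (rule Bochner_Integration.integrable_bound)
    show "integrable lborel (\<lambda>t. B * (indicator {a..b} t * node_weight m z s t))"
      using assms by (intro integrable_mult_right integrable_node_weight) auto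
    have "\<bar>node_weight m z s t * g t\<bar> \<le> \<bar>B * node_weight m z s t\<bar>" if "t \<in> {a..b}" for t
      using B[OF that] by (auto simp: abs_mult mult.commute intro!: mult_right_mono)
    then show "AE t in lborel. norm (indicator {a..b} t * node_weight m z s t * g t)
        \<le> norm (B * (indicator {a..b} t * node_weight m z s t))"
      by (intro AE_I2) (auto simp: indicator_def)
  qed measurable
qed

text \<open>
  The product of all \<open>t - z j\<close> except the \<open>k\<close>-th factor; these are the unnormalized Lagrange basis
  polynomials for the nodes \<open>z\<close>.
\<close>

definition node_poly :: "nat \<Rightarrow> (nat \<Rightarrow> real) \<Rightarrow> nat \<Rightarrow> real poly" where
  "node_poly m z k = (\<Prod>j\<in>{..m} - {k}. [:- z j, 1:])"

lemma poly_node_poly: "poly (node_poly m z k) t = (\<Prod>j\<in>{..m} - {k}. t - z j)"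
  by (simp add: node_poly_def poly_prod)

text \<open>
  The logarithmic derivative of \<open>\<Prod>j\<le>m. signed_powr (s j) (t - z j)\<close> is the sum of all \<open>s k / (t - z k)\<close>.
  The integrand is its derivative away from the nodes, with denominators cleared.
\<close>

lemma integral_node_weight_log_derivative:
  assumes inj: "inj_on z {..m}" and s: "\<And>j. j \<le> m \<Longrightarrow> s j > 0" and "a \<le> b"
  shows "(\<integral>t. indicator {a..b} t * node_weight m z s t * (\<Sum>k\<le>m. s k * poly (node_poly m z k) t) \<partial>lborel)
    = (\<Prod>j\<le>m. signed_powr (s j) (b - z j)) - (\<Prod>j\<le>m. signed_powr (s j) (a - z j))"
proof -
  let ?f = "\<lambda>t. node_weight m z s t * (\<Sum>k\<le>m. s k * poly (node_poly m z k) t)"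
  let ?\<Phi> = "\<lambda>t. \<Prod>j\<le>m. signed_powr (s j) (t - z j)"
  have 1: "(?f has_integral ?\<Phi> b - ?\<Phi> a) {a..b}"
  proof (rule fundamental_theorem_of_calculus_interior_strong[where S = "z ` {..m}"])
    fix t assume t: "t \<in> {a<..<b} - z ` {..m}"
    have "(?\<Phi> has_field_derivative (\<Sum>k\<le>m. s k * \<bar>t - z k\<bar> powr (s k - 1) * (\<Prod>j\<in>{..m}-{k}. signed_powr (s j) (t - z j)))) (at t)"
    proof (rule has_field_derivative_prod)
      fix k assume k: "k \<in> {..m}"
      have "(signed_powr (s k) has_field_derivative s k * \<bar>t - z k\<bar> powr (s k - 1)) (at (t - z k))"
        using k t s by (intro has_field_derivative_signed_powr) auto
      then show "((\<lambda>x. signed_powr (s k) (x - z k)) has_field_derivative s k * \<bar>t - z k\<bar> powr (s k - 1)) (at t)"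
        using DERIV_shift[of "signed_powr (s k)" _ t "- z k"] by simp
    qed
    also have "(\<Sum>k\<le>m. s k * \<bar>t - z k\<bar> powr (s k - 1) * (\<Prod>j\<in>{..m}-{k}. signed_powr (s j) (t - z j))) = ?f t"
      unfolding sum_distrib_left
    proof (intro sum.cong refl)
      fix k assume "k \<in> {..m}"
      then have "node_weight m z s t = \<bar>t - z k\<bar> powr (s k - 1) * (\<Prod>j\<in>{..m}-{k}. \<bar>t - z j\<bar> powr (s j - 1))"
        unfolding node_weight_def by (intro prod.remove) auto
      then show "s k * \<bar>t - z k\<bar> powr (s k - 1) * (\<Prod>j\<in>{..m}-{k}. signed_powr (s j) (t - z j)) =
          node_weight m z s t * (s k * poly (node_poly m z k) t)"
        by (simp add: signed_powr_def prod.distrib poly_node_poly)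
    qed
    finally show "(?\<Phi> has_vector_derivative ?f t) (at t)"
      by (simp add: has_real_derivative_iff_has_vector_derivative)
  qed (use assms in \<open>auto intro!: continuous_intros\<close>)
  have 2: "set_integrable lborel {a..b} ?f"
    unfolding set_integrable_def
    unfolding real_scaleR_def mult.assoc[symmetric]
    by (rule integrable_bounded_mult_cell) (use inj s in \<open>auto intro!: continuous_intros\<close>)
  have "(LINT t:{a..b}|lborel. ?f t) = ?\<Phi> b - ?\<Phi> a"
    using set_borel_integral_eq_integral(2)[OF 2] 1 by (simp add: integral_unique)
  then show ?thesis by (simp add: set_lebesgue_integral_def mult.assoc)
qed

section \<open>Integrals over products of cells\<close>

definition vandermonde :: "nat \<Rightarrow> (nat \<Rightarrow> real) \<Rightarrow> real" where
  "vandermonde m x = (\<Prod>i=1..m. \<Prod>j\<in>{i<..m}. x j - x i)"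

lemma vandermonde_Suc: "vandermonde (Suc m) x = vandermonde m x * (\<Prod>i=1..m. x (Suc m) - x i)"
proof -
  have "{i<..Suc m} = insert (Suc m) {i<..m}" if "i \<le> m" for i
    using that by auto
  then have "(\<Prod>j\<in>{i<..Suc m}. x j - x i) = (x (Suc m) - x i) * (\<Prod>j\<in>{i<..m}. x j - x i)" if "i \<le> m" for i
    using that by simp
  then have "(\<Prod>i=1..m. \<Prod>j\<in>{i<..Suc m}. x j - x i) = (\<Prod>i=1..m. x (Suc m) - x i) * vandermonde m x"
    by (simp add: vandermonde_def prod.distrib)
  then show ?thesis
    by (simp add: vandermonde_def)
qed

lemma vandermonde_0 [simp]: "vandermonde 0 x = 1"
  by (simp add: vandermonde_def)

lemma vandermonde_cong:
  "(\<And>i. i \<in> {1..m} \<Longrightarrow> x i = y i) \<Longrightarrow> vandermonde m x = vandermonde m y"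
  unfolding vandermonde_def by (intro prod.cong) auto

text \<open>
  As a function of one coordinate, the Vandermonde product is a multiple of the monic polynomial that
  has its zeros at the other coordinates.  The exchange argument for the averaged
  characteristic polynomial rests on this.
\<close>

lemma vandermonde_fun_upd:
  assumes "i \<in> {1..m}"
  shows "\<exists>c. \<forall>u. vandermonde m (x(i := u)) = c * (\<Prod>r\<in>{1..m} - {i}. u - x r)"
  using assms
proof (induction m)
  case (Suc m)
  show ?case
  proof (cases "i = Suc m")
    case True
    have "vandermonde m (x(i := u)) = vandermonde m x" for u
      using True by (intro vandermonde_cong) auto
    moreover have "(\<Prod>r=1..m. (x(i := u)) (Suc m) - (x(i := u)) r) = (\<Prod>r\<in>{1..Suc m} - {i}. u - x r)" for u
      using True by (intro prod.cong) auto
    ultimately have "vandermonde (Suc m) (x(i := u)) = vandermonde m x * (\<Prod>r\<in>{1..Suc m} - {i}. u - x r)" for u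
      by (simp only: vandermonde_Suc)
    then show ?thesis by blast
  next
    case False
    then have i: "i \<in> {1..m}" using Suc.prems by auto
    then obtain c where c: "\<And>u. vandermonde m (x(i := u)) = c * (\<Prod>r\<in>{1..m} - {i}. u - x r)"
      using Suc.IH[OF i] by metis
    let ?d = "\<Prod>r\<in>{1..m} - {i}. x (Suc m) - x r"
    have "(\<Prod>r=1..m. (x(i := u)) (Suc m) - (x(i := u)) r) = (x (Suc m) - u) * ?d" for u
      using i by (subst prod.remove[of _ i]) (auto intro!: prod.cong)
    moreover have "{1..Suc m} - {i} = insert (Suc m) ({1..m} - {i})" using i by auto
    then have "(\<Prod>r\<in>{1..Suc m} - {i}. u - x r) = (u - x (Suc m)) * (\<Prod>r\<in>{1..m} - {i}. u - x r)" for u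
      by simp
    ultimately have "vandermonde (Suc m) (x(i := u)) = - c * ?d * (\<Prod>r\<in>{1..Suc m} - {i}. u - x r)" for u
      unfolding vandermonde_Suc c by (simp only:) (simp add: algebra_simps)
    then show ?thesis by blast
  qed
qed simp

lemma borel_measurable_vandermonde [measurable]:
  assumes "\<And>i. i \<in> {1..m} \<Longrightarrow> (\<lambda>w. f w i) \<in> borel_measurable M"
  shows "(\<lambda>w. vandermonde m (f w)) \<in> borel_measurable M"
  unfolding vandermonde_def using assms by (intro borel_measurable_prod borel_measurable_diff) auto

definition cell_weight :: "nat \<Rightarrow> (nat \<Rightarrow> real) \<Rightarrow> (nat \<Rightarrow> real) \<Rightarrow> nat \<Rightarrow> real \<Rightarrow> real" where
  "cell_weight m z s i t = indicator {z (i - 1)..z i} t * node_weight m z s t"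

lemma cell_weight_nonneg [simp]: "cell_weight m z s i t \<ge> 0"
  by (simp add: cell_weight_def)

lemma borel_measurable_cell_weight [measurable]: "cell_weight m z s i \<in> borel_measurable borel"
  unfolding cell_weight_def by measurable

text \<open>
  The factor \<open>h\<close> is a test function: \<open>h = 1\<close> gives the Dixon-Anderson integrand, and
  \<open>h x = (\<Prod>r. t - x r)\<close> averages the characteristic polynomial of \<open>x\<close>.  The cell indicators are part
  of the weights, so that the integral runs over a full product space.
\<close>

definition dixon_integrand ::
  "nat \<Rightarrow> (nat \<Rightarrow> real) \<Rightarrow> (nat \<Rightarrow> real) \<Rightarrow> ((nat \<Rightarrow> real) \<Rightarrow> real) \<Rightarrow> (nat \<Rightarrow> real) \<Rightarrow> real" where
  "dixon_integrand m z s h x = h x * (vandermonde m x * (\<Prod>i=1..m. cell_weight m z s i (x i)))"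

definition dixon_integral ::
  "nat \<Rightarrow> (nat \<Rightarrow> real) \<Rightarrow> (nat \<Rightarrow> real) \<Rightarrow> ((nat \<Rightarrow> real) \<Rightarrow> real) \<Rightarrow> real" where
  "dixon_integral m z s h = (\<integral>x. dixon_integrand m z s h x \<partial>(\<Pi>\<^sub>M i\<in>{1..m}. lborel))"

definition in_cells :: "nat \<Rightarrow> (nat \<Rightarrow> real) \<Rightarrow> (nat \<Rightarrow> real) \<Rightarrow> bool" where
  "in_cells m z x \<longleftrightarrow> (\<forall>i\<in>{1..m}. z (i - 1) \<le> x i \<and> x i \<le> z i)"

lemma dixon_integrand_outside: "\<not> in_cells m z x \<Longrightarrow> dixon_integrand m z s h x = 0"
  by (force simp: dixon_integrand_def in_cells_def cell_weight_def)

interpretation lborel_product: product_sigma_finite "\<lambda>_. lborel :: real measure"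
  by standard

lemma degree_node_poly: "k \<le> m \<Longrightarrow> degree (node_poly m z k) = m"
  by (simp add: node_poly_def degree_prod_eq_sum_degree)

lemma coeff_node_poly: "k \<le> m \<Longrightarrow> coeff (node_poly m z k) m = 1"
  using lead_coeff_prod[of "\<lambda>j. [:- z j, 1:]" "{..m} - {k}"] degree_node_poly[of k m z]
  by (simp add: node_poly_def)

lemma lagrange_sum_node_poly:
  fixes z :: "nat \<Rightarrow> real"
  assumes "inj_on z {..m}" and "degree p \<le> m"
  shows "p = (\<Sum>k\<le>m. smult (poly p (z k) / poly (node_poly m z k) (z k)) (node_poly m z k))"
proof (rule poly_eqI_degree[where A = "z ` {..m}"])
  have card: "card (z ` {..m}) = Suc m" using assms by (simp add: card_image)
  show "degree p < card (z ` {..m})" using assms card by simp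
  have "degree (\<Sum>k\<le>m. smult (poly p (z k) / poly (node_poly m z k) (z k)) (node_poly m z k)) \<le> m"
    by (intro degree_sum_le order.trans[OF degree_smult_le]) (auto simp: degree_node_poly)
  then show "degree (\<Sum>k\<le>m. smult (poly p (z k) / poly (node_poly m z k) (z k)) (node_poly m z k)) < card (z ` {..m})"
    using card by simp
  fix t assume "t \<in> z ` {..m}"
  then obtain l where l: "l \<le> m" "t = z l" by auto
  have "poly (node_poly m z k) (z l) = 0" if "k \<le> m" "k \<noteq> l" for k
    using that l by (auto simp: poly_node_poly)
  moreover have "poly (node_poly m z l) (z l) \<noteq> 0"
    using l assms by (auto simp: poly_node_poly inj_on_def)
  ultimately show "poly p t = poly (\<Sum>k\<le>m. smult (poly p (z k) / poly (node_poly m z k) (z k)) (node_poly m z k)) t"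
    using l by (simp add: poly_sum sum.remove[of "{..m}" l])
qed

locale weighted_nodes =
  fixes m :: nat and z s :: "nat \<Rightarrow> real"
  assumes strict: "strict_mono_on {..m} z"
    and pos: "\<And>j. j \<le> m \<Longrightarrow> s j > 0"
begin

lemma inj: "inj_on z {..m}"
  using strict by (rule strict_mono_on_imp_inj_on)

lemma less: "i < j \<Longrightarrow> j \<le> m \<Longrightarrow> z i < z j"
  using strict by (auto simp: strict_mono_on_def)

lemma le: "i \<le> j \<Longrightarrow> j \<le> m \<Longrightarrow> z i \<le> z j"
  using less by (cases "i = j") (auto intro: less_imp_le)

lemma cell_less: "i \<in> {1..m} \<Longrightarrow> z (i - 1) < z i"
  by (rule less) auto

lemma in_cells_bounds:
  assumes "in_cells m z x" and "i \<in> {1..m}"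
  shows "z 0 \<le> x i" and "x i \<le> z m"
  using assms le[of 0 "i - 1"] le[of i m] by (force simp: in_cells_def)+

lemma integrable_cell:
  assumes "continuous_on UNIV g"
  shows "integrable lborel (\<lambda>t. cell_weight m z s i t * g t)"
  unfolding cell_weight_def using inj pos assms by (rule integrable_bounded_mult_cell)

lemma integrable_dixon_integrand:
  assumes [measurable]: "h \<in> borel_measurable (\<Pi>\<^sub>M i\<in>{1..m}. lborel)"
    and h: "\<And>x. in_cells m z x \<Longrightarrow> \<bar>h x\<bar> \<le> B"
  shows "integrable (\<Pi>\<^sub>M i\<in>{1..m}. lborel) (dixon_integrand m z s h)"
proof -
  define V where "V = (\<Prod>i=1..m. \<Prod>j\<in>{i<..m}. (z m - z 0))"
  have V: "\<bar>vandermonde m x\<bar> \<le> V" if "in_cells m z x" for x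
    unfolding vandermonde_def V_def abs_prod
    using in_cells_bounds[OF that]
    by (intro prod_mono conjI prod_nonneg) (auto simp: abs_le_iff intro!: diff_mono)
  show ?thesis
  proof (rule Bochner_Integration.integrable_bound)
    have "integrable lborel (\<lambda>t. cell_weight m z s i t)" for i
      using integrable_cell[of "\<lambda>_. 1"] by simp
    then show "integrable (\<Pi>\<^sub>M i\<in>{1..m}. lborel) (\<lambda>x. B * V * (\<Prod>i=1..m. cell_weight m z s i (x i)))"
      by (intro integrable_mult_right lborel_product.product_integrable_prod) auto
    show "dixon_integrand m z s h \<in> borel_measurable (\<Pi>\<^sub>M i\<in>{1..m}. lborel)"
      unfolding dixon_integrand_def by measurable
    have "\<bar>dixon_integrand m z s h x\<bar> \<le> \<bar>B * V * (\<Prod>i=1..m. cell_weight m z s i (x i))\<bar>" for x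
    proof (cases "in_cells m z x")
      case True
      have "\<bar>h x\<bar> * \<bar>vandermonde m x\<bar> \<le> \<bar>B * V\<bar>"
        using mult_mono[OF h[OF True] V[OF True]] h[OF True]
        by (intro order.trans[OF _ abs_ge_self]) auto
      then show ?thesis
        by (auto simp: dixon_integrand_def abs_mult mult.assoc[symmetric] intro!: mult_right_mono)
    qed (simp add: dixon_integrand_outside)
    then show "AE x in (\<Pi>\<^sub>M i\<in>{1..m}. lborel). norm (dixon_integrand m z s h x)
        \<le> norm (B * V * (\<Prod>i=1..m. cell_weight m z s i (x i)))"
      by simp
  qed
qed

lemma integrable_charpoly:
  "integrable (\<Pi>\<^sub>M i\<in>{1..m}. lborel) (dixon_integrand m z s (\<lambda>x. c * (\<Prod>r=1..m. t - x r)))"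
proof (rule integrable_dixon_integrand)
  fix x assume x: "in_cells m z x"
  show "\<bar>c * (\<Prod>r=1..m. t - x r)\<bar> \<le> \<bar>c\<bar> * (\<Prod>r=1..m. \<bar>t\<bar> + \<bar>z 0\<bar> + \<bar>z m\<bar>)"
    unfolding abs_mult abs_prod
    using in_cells_bounds[OF x] by (intro mult_left_mono prod_mono) (auto, fastforce)
qed measurable

lemma integral_cell_log_derivative_eq_0:
  assumes "i \<in> {1..m}"
  shows "(\<integral>t. cell_weight m z s i t * (\<Sum>k\<le>m. s k * poly (node_poly m z k) t) \<partial>lborel) = 0"
proof -
  have 0: "(\<Prod>j\<le>m. signed_powr (s j) (z i - z j)) = 0" if "i \<le> m" for i
    using that by (auto simp: prod_zero_iff signed_powr_def)
  have "(\<integral>t. cell_weight m z s i t * (\<Sum>k\<le>m. s k * poly (node_poly m z k) t) \<partial>lborel) =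
      (\<Prod>j\<le>m. signed_powr (s j) (z i - z j)) - (\<Prod>j\<le>m. signed_powr (s j) (z (i - 1) - z j))"
    unfolding cell_weight_def using cell_less[OF assms]
    by (intro integral_node_weight_log_derivative inj pos) auto
  also have "\<dots> = 0"
    using assms by (subst (1 2) 0) auto
  finally show ?thesis .
qed

text \<open>
  A polynomial without a zero inside a cell has constant sign there, so its weighted integral over the
  cell is not zero.  Thus \<open>q\<close> has \<open>m\<close> zeros in the \<open>m\<close> disjoint cells, more than its degree allows.
\<close>

lemma poly_orthogonal_cells_eq_0:
  assumes "degree q < m \<or> q = 0"
    and orth: "\<And>i. i \<in> {1..m} \<Longrightarrow> (\<integral>t. cell_weight m z s i t * poly q t \<partial>lborel) = 0"
  shows "q = 0"
proof -
  have root: "\<exists>t\<in>{z (i - 1)<..<z i}. poly q t = 0" if i: "i \<in> {1..m}" for i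
  proof (rule ccontr)
    assume no: "\<not> ?thesis"
    let ?I = "{z (i - 1)<..<z i}"
    let ?f = "\<lambda>t. cell_weight m z s i t * poly q t"
    have int: "integrable lborel ?f" by (intro integrable_cell continuous_intros)
    obtain \<sigma> :: real where \<sigma>: "\<sigma> \<noteq> 0" "\<And>t. t \<in> ?I \<Longrightarrow> \<sigma> * poly q t > 0"
    proof (cases "\<forall>t\<in>?I. poly q t > 0")
      case True
      then show ?thesis by (intro that[of 1]) auto
    next
      case False
      then obtain u where u: "u \<in> ?I" "poly q u < 0" using no by force
      have "poly q t < 0" if t: "t \<in> ?I" for t
      proof (rule ccontr)
        assume "\<not> poly q t < 0"
        then have "poly q t > 0" using no t by force
        moreover have "connected (poly q ` ?I)"
          by (intro connected_continuous_image continuous_intros) auto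
        then have "{poly q u..poly q t} \<subseteq> poly q ` ?I"
          using u t by (intro connected_contains_Icc) auto
        ultimately have "0 \<in> poly q ` ?I"
          using u by (auto simp: subset_iff)
        then show False using no by force
      qed
      then show ?thesis by (intro that[of "- 1"]) auto
    qed
    have "AE t in lborel. \<sigma> * ?f t = 0"
    proof (rule integral_nonneg_eq_0_iff_AE[THEN iffD1])
      show "integrable lborel (\<lambda>t. \<sigma> * ?f t)" using int by simp
      have "AE t in lborel. t \<noteq> z (i - 1) \<and> t \<noteq> z i"
        by (intro AE_conjI AE_lborel_singleton)
      then show "AE t in lborel. 0 \<le> \<sigma> * ?f t"
      proof eventually_elim
        case (elim t)
        then show ?case
        proof (cases "t \<in> ?I")
          case True
          have "0 \<le> cell_weight m z s i t * (\<sigma> * poly q t)"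
            by (intro mult_nonneg_nonneg cell_weight_nonneg less_imp_le \<sigma>(2) True)
          then show ?thesis by (simp add: algebra_simps)
        qed (use elim in \<open>auto simp: cell_weight_def indicator_def\<close>)
      qed
      show "(\<integral>t. \<sigma> * ?f t \<partial>lborel) = 0" using orth[OF i] by simp
    qed
    moreover have "\<sigma> * ?f t \<noteq> 0" if t: "t \<in> ?I" for t
    proof -
      have "t \<noteq> z j" if "j \<le> m" for j
      proof (cases "j \<le> i - 1")
        case True
        then show ?thesis using t i le[of j "i - 1"] by force
      next
        case False
        then show ?thesis using t i le[of i j] that by force
      qed
      then have "cell_weight m z s i t > 0"
        using t by (auto simp: cell_weight_def node_weight_def intro!: prod_pos)
      then show ?thesis using \<sigma>(2)[OF t] \<sigma>(1) by auto
    qed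
    ultimately have "AE t in lborel. t \<notin> ?I" by auto
    then have "emeasure lborel ?I = 0"
      by (subst (asm) AE_iff_measurable[of ?I]) auto
    then show False using cell_less[OF i] by simp
  qed
  then obtain \<rho> where \<rho>: "\<And>i. i \<in> {1..m} \<Longrightarrow> \<rho> i \<in> {z (i - 1)<..<z i} \<and> poly q (\<rho> i) = 0"
    by metis
  have "strict_mono_on {1..m} \<rho>"
  proof (rule strict_mono_onI)
    fix i j :: nat assume ij: "i \<in> {1..m}" "j \<in> {1..m}" "i < j"
    then have "z i \<le> z (j - 1)" by (intro le) auto
    then show "\<rho> i < \<rho> j" using \<rho>[OF ij(1)] \<rho>[OF ij(2)] by auto
  qed
  then have card: "card (\<rho> ` {1..m}) = m"
    using strict_mono_on_imp_inj_on card_image by fastforce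
  show ?thesis
  proof (rule ccontr)
    assume "q \<noteq> 0"
    then have "card (\<rho> ` {1..m}) \<le> card {t. poly q t = 0}"
      using \<rho> by (intro card_mono poly_roots_finite) auto
    also have "\<dots> \<le> degree q" using \<open>q \<noteq> 0\<close> by (rule card_poly_roots_bound)
    finally show False using assms(1) \<open>q \<noteq> 0\<close> card by simp
  qed
qed

section \<open>The averaged characteristic polynomial\<close>

text \<open>
  The coefficients of the monic polynomial with zeros \<open>x\<close> in the basis \<open>node_poly\<close>.  They separate the
  variable \<open>t\<close> from \<open>x\<close>, so that averages over \<open>x\<close> of the polynomial commute with integration over
  \<open>t\<close> by mere linearity.
\<close>

definition lagrange_coeff :: "nat \<Rightarrow> (nat \<Rightarrow> real) \<Rightarrow> real" where
  "lagrange_coeff k x = inverse (poly (node_poly m z k) (z k)) * (\<Prod>r=1..m. z k - x r)"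

lemma
  shows charpoly_eq_lagrange:
    "(\<Prod>r=1..m. t - x r) = (\<Sum>k\<le>m. lagrange_coeff k x * poly (node_poly m z k) t)" (is ?A)
    and sum_lagrange_coeff: "(\<Sum>k\<le>m. lagrange_coeff k x) = 1" (is ?B)
proof -
  define p where "p = (\<Prod>r=1..m. [:- x r, 1:])"
  have poly_p: "poly p t = (\<Prod>r=1..m. t - x r)" for t
    by (simp add: p_def poly_prod)
  have deg: "degree p = m"
    by (simp add: p_def degree_prod_eq_sum_degree)
  have lead: "coeff p m = 1"
    using lead_coeff_prod[of "\<lambda>r. [:- x r, 1:]" "{1..m}"] deg by (simp add: p_def)
  have p: "p = (\<Sum>k\<le>m. smult (lagrange_coeff k x) (node_poly m z k))"
    using lagrange_sum_node_poly[OF inj, of p] deg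
    by (simp add: lagrange_coeff_def poly_p field_simps)
  show ?A using arg_cong[OF p, of "\<lambda>p. poly p t"] by (simp add: poly_p poly_sum)
  show ?B using arg_cong[OF p, of "\<lambda>p. coeff p m"] lead by (simp add: coeff_sum coeff_node_poly)
qed

lemma
  fixes a :: "nat \<Rightarrow> real"
  shows integrable_sum_lagrange_coeff:
      "integrable (\<Pi>\<^sub>M i\<in>{1..m}. lborel) (dixon_integrand m z s (\<lambda>x. \<Sum>k\<le>m. lagrange_coeff k x * a k))"
    and dixon_integral_sum_lagrange_coeff:
      "dixon_integral m z s (\<lambda>x. \<Sum>k\<le>m. lagrange_coeff k x * a k) =
       (\<Sum>k\<le>m. dixon_integral m z s (lagrange_coeff k) * a k)"
proof -
  have eq: "dixon_integrand m z s (\<lambda>x. \<Sum>k\<le>m. lagrange_coeff k x * a k) =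
      (\<lambda>x. \<Sum>k\<le>m. dixon_integrand m z s (lagrange_coeff k) x * a k)"
    by (auto simp: dixon_integrand_def sum_distrib_right sum_distrib_left algebra_simps)
  have int: "integrable (\<Pi>\<^sub>M i\<in>{1..m}. lborel) (dixon_integrand m z s (lagrange_coeff k))" for k
    unfolding lagrange_coeff_def by (rule integrable_charpoly)
  show "integrable (\<Pi>\<^sub>M i\<in>{1..m}. lborel) (dixon_integrand m z s (\<lambda>x. \<Sum>k\<le>m. lagrange_coeff k x * a k))"
    unfolding eq by (intro Bochner_Integration.integrable_sum integrable_mult_left int)
  show "dixon_integral m z s (\<lambda>x. \<Sum>k\<le>m. lagrange_coeff k x * a k) =
      (\<Sum>k\<le>m. dixon_integral m z s (lagrange_coeff k) * a k)"
    unfolding dixon_integral_def eq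
    by (subst Bochner_Integration.integral_sum) (intro integrable_mult_left int, simp)
qed

definition cell_functional :: "nat \<Rightarrow> (real \<Rightarrow> real) \<Rightarrow> real" where
  "cell_functional i f = (\<integral>t. cell_weight m z s i t * f t \<partial>lborel)"

lemma cell_functional_sum:
  assumes "\<And>k. k \<in> K \<Longrightarrow> continuous_on UNIV (f k)"
  shows "cell_functional i (\<lambda>t. \<Sum>k\<in>K. a k * f k t) = (\<Sum>k\<in>K. a k * cell_functional i (f k))"
proof -
  have "cell_functional i (\<lambda>t. \<Sum>k\<in>K. a k * f k t) = (\<integral>t. (\<Sum>k\<in>K. a k * (cell_weight m z s i t * f k t)) \<partial>lborel)"
    unfolding cell_functional_def by (simp add: sum_distrib_left mult.left_commute)
  also have "\<dots> = (\<Sum>k\<in>K. a k * cell_functional i (f k))"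
    unfolding cell_functional_def using assms
    by (subst Bochner_Integration.integral_sum) (auto intro!: integrable_mult_right integrable_cell)
  finally show ?thesis .
qed

lemma cell_functional_charpoly:
  "cell_functional i (\<lambda>t. \<Prod>r=1..m. t - x r) =
   (\<Sum>k\<le>m. lagrange_coeff k x * cell_functional i (poly (node_poly m z k)))"
  unfolding charpoly_eq_lagrange by (intro cell_functional_sum continuous_intros)

text \<open>
  Both \<open>t\<close> and the coordinate \<open>x i\<close> run over cell \<open>i\<close> with the same weight.  With the other coordinates
  fixed, the integrand is \<open>(t - u) * Q t * Q u\<close> for \<open>u = x i\<close> and the monic polynomial \<open>Q\<close> with zeros at
  the other coordinates.  It is antisymmetric in \<open>t\<close> and \<open>u\<close>.
\<close>

lemma dixon_integral_cell_functional_charpoly: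
  assumes i: "i \<in> {1..m}"
  shows "dixon_integral m z s (\<lambda>x. cell_functional i (\<lambda>t. \<Prod>r=1..m. t - x r)) = 0"
proof -
  let ?I = "{1..m} - {i}"
  let ?g = "dixon_integrand m z s (\<lambda>x. cell_functional i (\<lambda>t. \<Prod>r=1..m. t - x r))"
  have ins: "insert i ?I = {1..m}" using i by auto
  have int: "integrable (\<Pi>\<^sub>M i\<in>{1..m}. lborel) ?g"
    unfolding cell_functional_charpoly by (rule integrable_sum_lagrange_coeff)
  have "(\<integral>u. ?g (x(i := u)) \<partial>lborel) = 0" for x
  proof -
    define Q where "Q t = (\<Prod>r\<in>?I. t - x r)" for t
    define W where "W = (\<Prod>r\<in>?I. cell_weight m z s r (x r))"
    \<comment> \<open>With these moments the inner integral over \<open>t\<close> is \<open>A1 - u * A0\<close>, and integrating over \<open>u\<close> gives \<open>A1 * A0 - A0 * A1\<close>.\<close>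
    define A0 where "A0 = cell_functional i Q"
    define A1 where "A1 = cell_functional i (\<lambda>t. t * Q t)"
    have cont: "continuous_on UNIV Q" "continuous_on UNIV (\<lambda>t. t * Q t)"
      unfolding Q_def by (auto intro!: continuous_intros)
    obtain c where c: "\<And>u. vandermonde m (x(i := u)) = c * Q u"
      using vandermonde_fun_upd[OF i, of x] by (auto simp: Q_def)
    have L: "cell_functional i (\<lambda>t. \<Prod>r=1..m. t - (x(i := u)) r) = A1 - u * A0" for u
    proof -
      have "(\<Prod>r=1..m. t - (x(i := u)) r) = t * Q t - u * Q t" for t
        using i by (subst prod.remove[of _ i]) (auto simp: Q_def algebra_simps intro!: prod.cong)
      then show ?thesis
        unfolding A0_def A1_def cell_functional_def
        using integrable_cell[OF cont(1)] integrable_cell[OF cont(2)]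
        by (simp add: right_diff_distrib mult.left_commute)
    qed
    have W: "(\<Prod>r=1..m. cell_weight m z s r ((x(i := u)) r)) = cell_weight m z s i u * W" for u
      using i by (subst prod.remove[of _ i]) (auto simp: W_def intro!: prod.cong)
    have "(\<integral>u. ?g (x(i := u)) \<partial>lborel) =
        (\<integral>u. c * W * A1 * (cell_weight m z s i u * Q u) - c * W * A0 * (cell_weight m z s i u * (u * Q u)) \<partial>lborel)"
      unfolding dixon_integrand_def L W c by (simp add: algebra_simps)
    also have "\<dots> = c * W * A1 * A0 - c * W * A0 * A1"
      using integrable_cell[OF cont(1)] integrable_cell[OF cont(2)]
      by (subst Bochner_Integration.integral_diff) (auto simp: A0_def A1_def cell_functional_def)
    finally show ?thesis by simp
  qed
  moreover have "dixon_integral m z s (\<lambda>x. cell_functional i (\<lambda>t. \<Prod>r=1..m. t - x r)) =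
      (\<integral>x. (\<integral>u. ?g (x(i := u)) \<partial>lborel) \<partial>(\<Pi>\<^sub>M i\<in>?I. lborel))"
    using lborel_product.product_integral_insert[of ?I i ?g] int
    unfolding dixon_integral_def ins by simp
  ultimately show ?thesis by simp
qed

text \<open>
  Both sides are orthogonal to the constants on every cell, and they have the same coefficient of
  \<open>t ^ m\<close>; so their difference vanishes by \<open>poly_orthogonal_cells_eq_0\<close>.
\<close>

theorem dixon_integral_charpoly:
  "(\<Sum>j\<le>m. s j) * dixon_integral m z s (\<lambda>x. \<Prod>r=1..m. t - x r) =
   dixon_integral m z s (\<lambda>_. 1) * (\<Sum>k\<le>m. s k * poly (node_poly m z k) t)"
proof -
  let ?J = "dixon_integral m z s"
  let ?S = "\<Sum>j\<le>m. s j"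
  define a where "a k = ?S * ?J (lagrange_coeff k) - ?J (\<lambda>_. 1) * s k" for k
  define q where "q = (\<Sum>k\<le>m. smult (a k) (node_poly m z k))"
  have J1: "(\<Sum>k\<le>m. ?J (lagrange_coeff k)) = ?J (\<lambda>_. 1)"
    using dixon_integral_sum_lagrange_coeff[of "\<lambda>_. 1"] by (simp add: sum_lagrange_coeff)
  have "coeff q m = (\<Sum>k\<le>m. a k)"
    by (simp add: q_def coeff_sum coeff_node_poly)
  also have "\<dots> = 0"
    by (simp add: a_def sum_subtractf J1 flip: sum_distrib_left)
  finally have "coeff q m = 0" .
  moreover have "degree q \<le> m"
    unfolding q_def by (intro degree_sum_le order.trans[OF degree_smult_le]) (auto simp: degree_node_poly)
  ultimately have deg: "degree q < m \<or> q = 0"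
    by (metis le_neq_implies_less leading_coeff_0_iff)
  have "q = 0"
  proof (rule poly_orthogonal_cells_eq_0[OF deg])
    fix i assume i: "i \<in> {1..m}"
    let ?L = "\<lambda>k. cell_functional i (poly (node_poly m z k))"
    have "(\<Sum>k\<le>m. ?J (lagrange_coeff k) * ?L k) = 0"
      using dixon_integral_cell_functional_charpoly[OF i]
      by (simp only: cell_functional_charpoly dixon_integral_sum_lagrange_coeff)
    moreover have "(\<Sum>k\<le>m. s k * ?L k) = 0"
      using integral_cell_log_derivative_eq_0[OF i]
        cell_functional_sum[of "{..m}" "\<lambda>k. poly (node_poly m z k)" i s]
      by (simp add: cell_functional_def continuous_intros)
    moreover have "(\<Sum>k\<le>m. a k * ?L k) =
        ?S * (\<Sum>k\<le>m. ?J (lagrange_coeff k) * ?L k) - ?J (\<lambda>_. 1) * (\<Sum>k\<le>m. s k * ?L k)"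
      unfolding a_def by (simp only: left_diff_distrib sum_subtractf sum_distrib_left mult.assoc)
    ultimately have "(\<Sum>k\<le>m. a k * ?L k) = 0" by simp
    moreover have "poly q = (\<lambda>t. \<Sum>k\<le>m. a k * poly (node_poly m z k) t)"
      by (auto simp: q_def poly_sum)
    ultimately have "cell_functional i (poly q) = 0"
      using cell_functional_sum[of "{..m}" "\<lambda>k. poly (node_poly m z k)" i a]
      by (simp add: continuous_intros)
    then show "(\<integral>t. cell_weight m z s i t * poly q t \<partial>lborel) = 0"
      by (simp add: cell_functional_def)
  qed
  then have "0 = (\<Sum>k\<le>m. a k * poly (node_poly m z k) t)"
    by (metis (no_types, lifting) poly_0 poly_smult poly_sum q_def sum.cong)
  also have "\<dots> = ?S * (\<Sum>k\<le>m. ?J (lagrange_coeff k) * poly (node_poly m z k) t)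
      - ?J (\<lambda>_. 1) * (\<Sum>k\<le>m. s k * poly (node_poly m z k) t)"
    unfolding a_def by (simp only: left_diff_distrib sum_subtractf sum_distrib_left mult.assoc)
  finally show ?thesis
    unfolding charpoly_eq_lagrange dixon_integral_sum_lagrange_coeff by simp
qed

end

section \<open>Dependence on the last exponent\<close>

lemma node_weight_fun_upd:
  "node_weight m z (s(m := q)) t = node_weight m z (s(m := p)) t * \<bar>t - z m\<bar> powr (q - p)"
proof -
  have "\<bar>t - z m\<bar> powr (q - 1) = \<bar>t - z m\<bar> powr (p - 1) * \<bar>t - z m\<bar> powr (q - p)"
    by (simp flip: powr_add)
  moreover have "(\<Prod>j\<in>{..m} - {m}. \<bar>t - z j\<bar> powr ((s(m := r)) j - 1)) = (\<Prod>j\<in>{..m} - {m}. \<bar>t - z j\<bar> powr (s j - 1))" for r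
    by (intro prod.cong) auto
  ultimately show ?thesis
    unfolding node_weight_def by (subst (1 2) prod.remove[of _ m]) auto
qed

lemma dixon_integral_cong:
  assumes "\<And>j. j \<le> m \<Longrightarrow> s j = s' j"
  shows "dixon_integral m z s h = dixon_integral m z s' h"
  using assms
  by (simp add: dixon_integral_def dixon_integrand_def cell_weight_def node_weight_def)

lemma dixon_integral_0: "dixon_integral 0 z s h = h (\<lambda>_. undefined)"
  by (simp add: dixon_integral_def dixon_integrand_def PiM_empty lebesgue_integral_count_space_finite)

context weighted_nodes
begin

lemma fun_upd_nodes: "p > 0 \<Longrightarrow> weighted_nodes m z (s(k := p))"
  using strict pos by unfold_locales auto

lemma vandermonde_nonneg:
  assumes "in_cells m z x"
  shows "vandermonde m x \<ge> 0"
  unfolding vandermonde_def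
proof (intro prod_nonneg)
  fix i j assume "i \<in> {1..m}" "j \<in> {i<..m}"
  then have "x i \<le> z i" "z i \<le> z (j - 1)" "z (j - 1) \<le> x j"
    using assms le[of i "j - 1"] by (auto simp: in_cells_def)
  then show "0 \<le> x j - x i" by simp
qed

lemma dixon_integrand_nonneg: "dixon_integrand m z s (\<lambda>_. 1) x \<ge> 0"
proof (cases "in_cells m z x")
  case True
  then show ?thesis
    unfolding dixon_integrand_def by (intro mult_nonneg_nonneg vandermonde_nonneg prod_nonneg) auto
qed (simp add: dixon_integrand_outside)

lemma integrable_dixon_1: "integrable (\<Pi>\<^sub>M i\<in>{1..m}. lborel) (dixon_integrand m z s (\<lambda>_. 1))"
  by (rule integrable_dixon_integrand[where B = 1]) auto

text \<open>
  Raising the last exponent by one multiplies the integrand by \<open>\<Prod>r. z m - x r\<close>, the characteristic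
  polynomial at \<open>t = z m\<close>, where only the basis polynomial with \<open>k = m\<close> survives.
\<close>

lemma dixon_integral_last_Suc:
  "(\<Sum>j\<le>m. s j) * dixon_integral m z (s(m := s m + 1)) (\<lambda>_. 1) =
   dixon_integral m z s (\<lambda>_. 1) * s m * (\<Prod>j<m. z m - z j)"
proof -
  have "dixon_integrand m z (s(m := s m + 1)) (\<lambda>_. 1) x = dixon_integrand m z s (\<lambda>x. \<Prod>r=1..m. z m - x r) x" for x
  proof (cases "in_cells m z x")
    case True
    have "cell_weight m z (s(m := s m + 1)) i (x i) = cell_weight m z s i (x i) * (z m - x i)" if "i \<in> {1..m}" for i
      using in_cells_bounds(2)[OF True that] node_weight_fun_upd[of m z s "s m + 1" "x i" "s m"]
      by (simp add: cell_weight_def)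
    then show ?thesis
      by (simp add: dixon_integrand_def prod.distrib)
  qed (simp add: dixon_integrand_outside)
  then have "dixon_integral m z (s(m := s m + 1)) (\<lambda>_. 1) = dixon_integral m z s (\<lambda>x. \<Prod>r=1..m. z m - x r)"
    unfolding dixon_integral_def by (intro Bochner_Integration.integral_cong refl)
  moreover have "(\<Sum>k\<le>m. s k * poly (node_poly m z k) (z m)) = s m * (\<Prod>j<m. z m - z j)"
  proof -
    have diff: "{..m} - {m} = {..<m}" by auto
    have "(\<Sum>k<m. s k * poly (node_poly m z k) (z m)) = 0"
      by (intro sum.neutral) (auto simp: poly_node_poly)
    then show ?thesis
      by (simp add: sum.remove[of "{..m}" m] diff poly_node_poly)
  qed
  ultimately show ?thesis
    using dixon_integral_charpoly[of "z m"] by (simp add: mult.assoc)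
qed

text \<open>
  On cell \<open>i\<close> the distance \<open>z m - x i\<close> is at most \<open>z m - z (i - 1)\<close>, and the product of these bounds is
  the product on the right-hand side.
\<close>

lemma dixon_integral_last_antimono:
  assumes "0 < p" and "p \<le> q"
  shows "dixon_integral m z (s(m := q)) (\<lambda>_. 1) \<le>
    dixon_integral m z (s(m := p)) (\<lambda>_. 1) * (\<Prod>j<m. z m - z j) powr (q - p)"
proof -
  let ?D = "\<Prod>j<m. z m - z j"
  interpret p: weighted_nodes m z "s(m := p)" using assms by (intro fun_upd_nodes) auto
  interpret q: weighted_nodes m z "s(m := q)" using assms by (intro fun_upd_nodes) auto
  have D: "?D powr (q - p) = (\<Prod>i=1..m. (z m - z (i - 1)) powr (q - p))"
  proof -
    have "?D powr (q - p) = (\<Prod>j<m. (z m - z j) powr (q - p))"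
      by (rule prod_powr_distrib)
    also have "\<dots> = (\<Prod>i=1..m. (z m - z (i - 1)) powr (q - p))"
      by (rule prod.reindex_bij_witness[of _ "\<lambda>i. i - 1" Suc]) auto
    finally show ?thesis .
  qed
  have "dixon_integrand m z (s(m := q)) (\<lambda>_. 1) x \<le> dixon_integrand m z (s(m := p)) (\<lambda>_. 1) x * ?D powr (q - p)" for x
  proof (cases "in_cells m z x")
    case True
    have "cell_weight m z (s(m := q)) i (x i) \<le> cell_weight m z (s(m := p)) i (x i) * (z m - z (i - 1)) powr (q - p)"
      if i: "i \<in> {1..m}" for i
    proof -
      have "z (i - 1) \<le> x i" using True i by (auto simp: in_cells_def)
      then have "\<bar>x i - z m\<bar> powr (q - p) \<le> (z m - z (i - 1)) powr (q - p)"
        using in_cells_bounds(2)[OF True i] assms by (intro powr_mono2) auto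
      then have "node_weight m z (s(m := q)) (x i) \<le> node_weight m z (s(m := p)) (x i) * (z m - z (i - 1)) powr (q - p)"
        unfolding node_weight_fun_upd[of m z s q _ p] by (intro mult_left_mono) auto
      then show ?thesis
        by (auto simp: cell_weight_def indicator_def)
    qed
    then have "(\<Prod>i=1..m. cell_weight m z (s(m := q)) i (x i)) \<le>
        (\<Prod>i=1..m. cell_weight m z (s(m := p)) i (x i) * (z m - z (i - 1)) powr (q - p))"
      by (intro prod_mono) auto
    then show ?thesis
      unfolding D dixon_integrand_def prod.distrib mult.assoc mult_1
      by (intro mult_left_mono vandermonde_nonneg True)
  qed (simp add: dixon_integrand_outside)
  then show ?thesis
    unfolding dixon_integral_def
    by (subst integral_mult_left_zero[symmetric])
      (intro integral_mono integrable_mult_left p.integrable_dixon_1 q.integrable_dixon_1)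
qed

end

text \<open>
  The quotient \<open>R\<close> of \<open>H\<close> by \<open>Beta _ S\<close> has period one.  Both functions are decreasing and change over
  one period only by the factor \<open>t / (S + t)\<close>, which tends to 1.  So \<open>R\<close> varies arbitrarily little over
  a late period, and hence is constant.
\<close>

lemma Beta_characterization:
  fixes H :: "real \<Rightarrow> real"
  assumes "S > 0"
    and antimono: "\<And>p q. 0 < p \<Longrightarrow> p \<le> q \<Longrightarrow> H q \<le> H p"
    and nonneg: "\<And>t. 0 < t \<Longrightarrow> 0 \<le> H t"
    and rec: "\<And>t. 0 < t \<Longrightarrow> (S + t) * H (t + 1) = t * H t"
    and "t > 0"
  shows "H t = S * H 1 * Beta t S"
proof -
  define B where "B t = Beta t S" for t
  define R where "R t = H t / B t" for t
  have B_pos: "B t > 0" if "t > 0" for t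
    using that \<open>S > 0\<close> by (simp add: B_def Beta_def Gamma_real_pos)
  have B_rec: "(S + t) * B (t + 1) = t * B t" if "t > 0" for t
    using that \<open>S > 0\<close> Beta_plus1_left[of t S] by (simp add: B_def nonpos_Ints_def algebra_simps)
  have R1: "R (t + 1) = R t" if "t > 0" for t
  proof -
    have "H (t + 1) = t * H t / (S + t)" "B (t + 1) = t * B t / (S + t)"
      using rec[OF that] B_rec[OF that] that \<open>S > 0\<close> by (simp_all add: field_simps)
    then show ?thesis using that \<open>S > 0\<close> by (simp add: R_def)
  qed
  have R_plus: "R (t + real n) = R t" if "t > 0" for t n
  proof (induction n)
    case (Suc n)
    then show ?case using R1[of "t + real n"] that by (simp add: algebra_simps)
  qed simp
  have eq: "R q = R p" if p: "0 < p" "p \<le> q" "q \<le> p + 1" for p q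
  proof -
    have bounds: "R p * (1 - S / (S + p + real n)) \<le> R q \<and> R q \<le> R p * (1 + S / (p + real n))" for n
    proof -
      define u v where "u = p + real n" and "v = q + real n"
      have uv: "0 < u" "u \<le> v" "v \<le> u + 1" "0 < v" using p by (auto simp: u_def v_def)
      have H: "H v \<le> H u" "H (u + 1) \<le> H v" using uv by (auto intro!: antimono)
      have B: "B v \<le> B u" "B (u + 1) \<le> B v"
        using uv \<open>S > 0\<close> by (auto simp: B_def intro!: Beta_real_mono)
      have H1: "H (u + 1) = u * H u / (S + u)" and B1: "B (u + 1) = u * B u / (S + u)"
        using rec[of u] B_rec[of u] uv \<open>S > 0\<close> by (simp_all add: field_simps)
      have "R v \<le> H u / B (u + 1)"
        unfolding R_def using H B uv by (intro frac_le nonneg B_pos) auto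
      also have "\<dots> = R u * ((S + u) / u)"
        using uv \<open>S > 0\<close> by (simp add: B1 R_def)
      finally have 1: "R v \<le> R u * ((S + u) / u)" .
      have "R u * (u / (S + u)) = H (u + 1) / B u"
        by (simp add: H1 R_def mult.commute)
      also have "\<dots> \<le> R v"
        unfolding R_def using H B uv by (intro frac_le nonneg B_pos) auto
      finally have 2: "R u * (u / (S + u)) \<le> R v" .
      have "R u = R p" "R v = R q" using R_plus p by (auto simp: u_def v_def)
      moreover have "u / (S + u) = 1 - S / (S + u)" "(S + u) / u = 1 + S / u"
        using uv \<open>S > 0\<close> by (simp_all add: field_simps)
      ultimately show ?thesis using 1 2 by (simp add: u_def add.assoc)
    qed
    have lim: "(\<lambda>n. S / (c + real n)) \<longlonglongrightarrow> 0" for c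
      by (intro tendsto_divide_0[OF tendsto_const] filterlim_at_top_imp_at_infinity
          filterlim_tendsto_add_at_top[OF tendsto_const] filterlim_real_sequentially)
    have "(\<lambda>n. R p * (1 - S / (S + p + real n))) \<longlonglongrightarrow> R p * (1 - 0)"
      by (intro tendsto_intros lim)
    then have "R p \<le> R q" using bounds by (intro LIMSEQ_le_const2) auto
    moreover have "(\<lambda>n. R p * (1 + S / (p + real n))) \<longlonglongrightarrow> R p * (1 + 0)"
      by (intro tendsto_intros lim)
    then have "R q \<le> R p" using bounds by (intro LIMSEQ_le_const) auto
    ultimately show ?thesis by simp
  qed
  \<comment> \<open>The natural number \<open>1 + n\<close> lies in \<open>[t, t + 1]\<close>.\<close>
  define n where "n = nat \<lfloor>t\<rfloor>"
  have "R (1 + real n) = R t"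
    using \<open>t > 0\<close> of_nat_floor[of t] unfolding n_def by (intro eq) linarith+
  then have "R t = R 1" using R_plus[of 1 n] by simp
  moreover have "B 1 = 1 / S"
  proof -
    have "Gamma (S + 1) = S * Gamma S"
      using \<open>S > 0\<close> by (intro Gamma_plus1) (auto elim: nonpos_Ints_cases)
    then show ?thesis
      using Gamma_real_pos[OF \<open>S > 0\<close>] by (simp add: B_def Beta_def add.commute)
  qed
  ultimately have "H t / B t = S * H 1"
    by (simp add: R_def)
  then have "H t = S * H 1 * B t"
    using B_pos[OF \<open>t > 0\<close>] by (simp add: divide_eq_eq)
  then show ?thesis by (simp add: B_def)
qed

section \<open>The Dixon-Anderson integral\<close>

context weighted_nodes
begin

text \<open>
  A last node with exponent 1 contributes no factor to the weight.  The new coordinate enters the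
  Vandermonde product through the characteristic polynomial of the others, and
  \<open>dixon_integral_charpoly\<close> turns the integral over it into one that has an explicit antiderivative.
\<close>

lemma dixon_integral_append_node:
  assumes "weighted_nodes (Suc m) z s" and [simp]: "s (Suc m) = 1"
  shows "(\<Sum>j\<le>m. s j) * dixon_integral (Suc m) z s (\<lambda>_. 1) =
    dixon_integral m z s (\<lambda>_. 1) * (\<Prod>j\<le>m. (z (Suc m) - z j) powr s j)"
proof -
  interpret big: weighted_nodes "Suc m" z s by fact
  let ?J = "dixon_integral m z s"
  let ?c = "z (Suc m)"
  define K where "K u = indicator {z m..?c} u * node_weight m z s u" for u
  define a where "a k = (\<integral>u. K u * poly (node_poly m z k) u \<partial>lborel)" for k
  have K_int: "integrable lborel (\<lambda>u. K u * g u)" if "continuous_on UNIV g" for g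
    unfolding K_def using inj pos that by (rule integrable_bounded_mult_cell)
  \<comment> \<open>The new node itself must be excluded, since \<open>0 powr 0 = 0\<close>.\<close>
  have nw: "node_weight (Suc m) z s u = node_weight m z s u" if "u \<noteq> ?c" for u
    using that by (simp add: node_weight_def)
  have cell: "cell_weight (Suc m) z s i u = cell_weight m z s i u" if "i \<in> {1..m}" for i u
    using nw[of u] big.less[of i "Suc m"] that by (auto simp: cell_weight_def indicator_def)
  have sumK: "(\<integral>u. K u * (\<Sum>k\<le>m. b k * poly (node_poly m z k) u) \<partial>lborel) = (\<Sum>k\<le>m. b k * a k)" for b
  proof -
    have "(\<lambda>u. K u * (\<Sum>k\<le>m. b k * poly (node_poly m z k) u)) =
        (\<lambda>u. \<Sum>k\<le>m. b k * (K u * poly (node_poly m z k) u))"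
      by (simp add: sum_distrib_left mult.left_commute)
    then show ?thesis
      unfolding a_def
      by (simp add: Bochner_Integration.integral_sum integrable_mult_right K_int continuous_intros)
  qed
  have inner: "(\<integral>u. dixon_integrand (Suc m) z s (\<lambda>_. 1) (x(Suc m := u)) \<partial>lborel) =
      dixon_integrand m z s (\<lambda>x. \<Sum>k\<le>m. lagrange_coeff k x * a k) x" for x
  proof -
    let ?C = "vandermonde m x * (\<Prod>i=1..m. cell_weight m z s i (x i))"
    have *: "dixon_integrand (Suc m) z s (\<lambda>_. 1) (x(Suc m := u)) =
        ?C * (cell_weight (Suc m) z s (Suc m) u * (\<Prod>r=1..m. u - x r))" for u
    proof -
      have "vandermonde m (x(Suc m := u)) = vandermonde m x"
        by (intro vandermonde_cong) auto
      moreover have "(\<Prod>i=1..m. (x(Suc m := u)) (Suc m) - (x(Suc m := u)) i) = (\<Prod>r=1..m. u - x r)"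
        by (intro prod.cong) auto
      moreover have "(\<Prod>i=1..m. cell_weight (Suc m) z s i ((x(Suc m := u)) i)) = (\<Prod>i=1..m. cell_weight m z s i (x i))"
        by (intro prod.cong) (auto simp: cell)
      ultimately show ?thesis
        by (simp add: dixon_integrand_def vandermonde_Suc prod.nat_ivl_Suc' mult_ac)
    qed
    have "AE u in lborel. u \<noteq> ?c" by (rule AE_lborel_singleton)
    then have "(\<integral>u. cell_weight (Suc m) z s (Suc m) u * (\<Prod>r=1..m. u - x r) \<partial>lborel) =
        (\<integral>u. K u * (\<Prod>r=1..m. u - x r) \<partial>lborel)"
      by (intro integral_cong_AE) (auto elim!: eventually_mono simp: K_def cell_weight_def nw)
    also have "\<dots> = (\<Sum>k\<le>m. lagrange_coeff k x * a k)"
      unfolding charpoly_eq_lagrange by (rule sumK)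
    finally show ?thesis
      unfolding * by (simp add: dixon_integrand_def)
  qed
  have "dixon_integral (Suc m) z s (\<lambda>_. 1) = ?J (\<lambda>x. \<Sum>k\<le>m. lagrange_coeff k x * a k)"
    using lborel_product.product_integral_insert[of "{1..m}" "Suc m" "dixon_integrand (Suc m) z s (\<lambda>_. 1)"]
      big.integrable_dixon_1
    by (simp add: dixon_integral_def inner atLeastAtMostSuc_conv)
  also have "\<dots> = (\<integral>u. K u * ?J (\<lambda>x. \<Prod>r=1..m. u - x r) \<partial>lborel)"
    unfolding charpoly_eq_lagrange dixon_integral_sum_lagrange_coeff sumK ..
  finally have "(\<Sum>j\<le>m. s j) * dixon_integral (Suc m) z s (\<lambda>_. 1) =
      (\<integral>u. (\<Sum>j\<le>m. s j) * (K u * ?J (\<lambda>x. \<Prod>r=1..m. u - x r)) \<partial>lborel)"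
    by simp
  also have "\<dots> = (\<integral>u. ?J (\<lambda>_. 1) * (K u * (\<Sum>k\<le>m. s k * poly (node_poly m z k) u)) \<partial>lborel)"
    unfolding mult.left_commute[of "\<Sum>j\<le>m. s j"] dixon_integral_charpoly
    unfolding mult.left_commute[of "?J (\<lambda>_. 1)"] ..
  also have "\<dots> = ?J (\<lambda>_. 1) * (\<integral>u. K u * (\<Sum>k\<le>m. s k * poly (node_poly m z k) u) \<partial>lborel)"
    by (rule integral_mult_right_zero)
  also have "(\<integral>u. K u * (\<Sum>k\<le>m. s k * poly (node_poly m z k) u) \<partial>lborel) =
      (\<Prod>j\<le>m. signed_powr (s j) (?c - z j)) - (\<Prod>j\<le>m. signed_powr (s j) (z m - z j))"
    unfolding K_def by (rule integral_node_weight_log_derivative) (use inj pos big.le in auto)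
  also have "(\<Prod>j\<le>m. signed_powr (s j) (z m - z j)) = 0"
    by (auto simp: signed_powr_def)
  also have "(\<Prod>j\<le>m. signed_powr (s j) (?c - z j)) = (\<Prod>j\<le>m. (?c - z j) powr s j)"
  proof (rule prod.cong[OF refl])
    fix j assume "j \<in> {..m}"
    then show "signed_powr (s j) (?c - z j) = (?c - z j) powr s j"
      using big.less[of j "Suc m"] pos[of j] by (simp add: signed_powr_conv_max)
  qed
  finally show ?thesis by simp
qed

end

text \<open>
  The induction step starts from exponent 1 at the new node, which \<open>dixon_integral_append_node\<close>
  reduces to fewer nodes, and moves this exponent to its value by \<open>Beta_characterization\<close>.  The division
  by \<open>D powr t\<close> below makes the integral a decreasing function of the exponent \<open>t\<close>.
\<close>

theorem dixon_anderson_integral: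
  assumes "weighted_nodes m z s"
  shows "dixon_integral m z s (\<lambda>_. 1) =
    (\<Prod>j\<le>m. Gamma (s j)) / Gamma (\<Sum>j\<le>m. s j) *
    (\<Prod>i\<le>m. \<Prod>j\<in>{i<..m}. (z j - z i) powr (s i + s j - 1))"
  using assms
proof (induction m)
  case 0
  then interpret weighted_nodes 0 z s .
  show ?case using Gamma_real_pos[OF pos[of 0]] by (simp add: dixon_integral_0)
next
  case (Suc m)
  interpret big: weighted_nodes "Suc m" z s by fact
  interpret small: weighted_nodes m z s
    using big.strict big.pos by unfold_locales (auto simp: strict_mono_on_def)
  define S where "S = (\<Sum>j\<le>m. s j)"
  define D where "D = (\<Prod>j\<le>m. z (Suc m) - z j)"
  define F where "F t = dixon_integral (Suc m) z (s(Suc m := t)) (\<lambda>_. 1)" for t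
  define t where "t = s (Suc m)"
  have "S > 0" unfolding S_def by (intro sum_pos small.pos) auto
  have "t > 0" unfolding t_def by (intro big.pos) auto
  have "D > 0" unfolding D_def by (intro prod_pos) (use big.less in auto)
  have upd: "weighted_nodes (Suc m) z (s(Suc m := p))" if "p > 0" for p
    using that by (rule big.fun_upd_nodes)
  have sum_upd: "(\<Sum>j\<le>m. (s(Suc m := p)) j) = S" for p
    unfolding S_def by (intro sum.cong) auto
  have "F t / D powr t = S * (F 1 / D powr 1) * Beta t S"
  proof (rule Beta_characterization[where H = "\<lambda>t. F t / D powr t"])
    fix p q :: real assume pq: "0 < p" "p \<le> q"
    have "F q \<le> F p * D powr (q - p)"
      using weighted_nodes.dixon_integral_last_antimono[OF upd[OF pq(1)] pq]
      by (simp add: F_def D_def lessThan_Suc_atMost)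
    then show "F q / D powr q \<le> F p / D powr p"
      using \<open>D > 0\<close> by (simp add: powr_diff divide_simps)
  next
    fix p :: real assume "0 < p"
    then interpret p: weighted_nodes "Suc m" z "s(Suc m := p)" by (rule upd)
    show "0 \<le> F p / D powr p"
      unfolding F_def dixon_integral_def
      by (intro divide_nonneg_nonneg integral_nonneg_AE AE_I2 p.dixon_integrand_nonneg) auto
    have "(S + p) * F (p + 1) = F p * p * D"
      using p.dixon_integral_last_Suc sum_upd[of p]
      by (simp add: F_def D_def lessThan_Suc_atMost)
    then show "(S + p) * (F (p + 1) / D powr (p + 1)) = p * (F p / D powr p)"
      using \<open>D > 0\<close> by (simp add: powr_add divide_simps)
  qed fact+
  then have "F t = S * F 1 * Beta t S * D powr (t - 1)"
    using \<open>D > 0\<close> by (simp add: powr_diff field_simps)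
  moreover have "S * F 1 = dixon_integral m z s (\<lambda>_. 1) * (\<Prod>j\<le>m. (z (Suc m) - z j) powr s j)"
  proof -
    interpret one: weighted_nodes m z "s(Suc m := 1)"
      using small.strict small.pos by unfold_locales auto
    have "dixon_integral m z (s(Suc m := 1)) (\<lambda>_. 1) = dixon_integral m z s (\<lambda>_. 1)"
      by (intro dixon_integral_cong) auto
    moreover have "(\<Prod>j\<le>m. (z (Suc m) - z j) powr (s(Suc m := 1)) j) = (\<Prod>j\<le>m. (z (Suc m) - z j) powr s j)"
      by (intro prod.cong) auto
    ultimately show ?thesis
      using one.dixon_integral_append_node[OF upd] sum_upd[of 1] by (simp add: F_def)
  qed
  moreover have "(\<Prod>j\<le>m. (z (Suc m) - z j) powr s j) * D powr (t - 1) =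
      (\<Prod>j\<le>m. (z (Suc m) - z j) powr (s j + t - 1))"
    unfolding D_def prod_powr_distrib prod.distrib[symmetric]
    by (simp add: algebra_simps flip: powr_add)
  moreover have "(\<Prod>i\<le>Suc m. \<Prod>j\<in>{i<..Suc m}. (z j - z i) powr (s i + s j - 1)) =
      (\<Prod>i\<le>m. \<Prod>j\<in>{i<..m}. (z j - z i) powr (s i + s j - 1)) *
      (\<Prod>i\<le>m. (z (Suc m) - z i) powr (s i + t - 1))"
  proof -
    have "{i<..Suc m} = insert (Suc m) {i<..m}" if "i \<le> m" for i
      using that by auto
    then show ?thesis
      by (simp add: t_def prod.distrib mult.commute)
  qed
  moreover have "F t = dixon_integral (Suc m) z s (\<lambda>_. 1)"
    by (simp add: F_def t_def)
  moreover have "Gamma S > 0" using \<open>S > 0\<close> by (rule Gamma_real_pos)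
  moreover have "(\<Sum>j\<le>Suc m. s j) = t + S" by (simp add: S_def t_def)
  moreover have "(\<Prod>j\<le>Suc m. Gamma (s j)) = (\<Prod>j\<le>m. Gamma (s j)) * Gamma t" by (simp add: t_def)
  ultimately show ?case
    using Suc.IH[OF small.weighted_nodes_axioms]
    by (simp add: Beta_def S_def[symmetric] del: prod.atMost_Suc sum.atMost_Suc)
qed

section \<open>The kernel has mass one\<close>

lemma borel_measurable_component:
  "i \<in> I \<Longrightarrow> (\<lambda>x. x i) \<in> borel_measurable (\<Pi>\<^sub>M i\<in>I. lborel)"
  using measurable_component_singleton[of i I "\<lambda>_. lborel"] by simp

lemma weyl_subset_space: "weyl N \<subseteq> space (\<Pi>\<^sub>M i\<in>{1..N}. lborel)"
  by (auto simp: weyl_def space_PiM PiE_def Pi_def)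

lemma sets_weyl: "weyl N \<in> sets (\<Pi>\<^sub>M i\<in>{1..N}. lborel)"
proof -
  have "weyl N = {x \<in> space (\<Pi>\<^sub>M i\<in>{1..N}. lborel). (\<forall>i\<in>{1..N}. 0 \<le> x i \<and> x i \<le> 1) \<and>
      (\<forall>i\<in>{1..N}. \<forall>j\<in>{1..N}. i \<le> j \<longrightarrow> x i \<le> x j)}"
    by (auto simp: weyl_def space_PiM PiE_def Pi_def mono_on_def)
  also have "\<dots> \<in> sets (\<Pi>\<^sub>M i\<in>{1..N}. lborel)"
    by (intro sets.sets_Collect_conj sets.sets_Collect_finite_All sets.sets_Collect_imp
        sets.sets_Collect_const borel_measurable_le borel_measurable_const borel_measurable_component) auto
  finally show ?thesis .
qed

lemma space_weyl_lborel [simp]: "space (weyl_lborel N) = weyl N"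
  using weyl_subset_space[of N] by (auto simp: weyl_lborel_def space_restrict_space)

lemma sigma_finite_weyl_lborel: "sigma_finite_measure (weyl_lborel N)"
  unfolding weyl_lborel_def
  using sets_weyl by (intro sigma_finite_measure_restrict_space lborel_product.sigma_finite) auto

lemma borel_measurable_weyl_component:
  "i \<in> {1..N} \<Longrightarrow> (\<lambda>x. x i) \<in> borel_measurable (weyl_lborel N)"
  unfolding weyl_lborel_def by (intro measurable_restrict_space1 borel_measurable_component)

lemma borel_measurable_jacobi_weight [measurable]:
  "jacobi_weight N p q \<beta> \<in> borel_measurable (weyl_lborel N)"
  unfolding jacobi_weight_def
  by (intro borel_measurable_times borel_measurable_prod powr_real_measurable borel_measurable_diff
      borel_measurable_abs borel_measurable_const borel_measurable_weyl_component) auto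

lemma jacobi_weight_nonneg: "jacobi_weight N p q \<beta> x \<ge> 0"
  by (simp add: jacobi_weight_def prod_nonneg)

lemma nn_integral_weyl_lborel:
  "(\<integral>\<^sup>+ x. f x \<partial>weyl_lborel N) = (\<integral>\<^sup>+ x. f x * indicator (weyl N) x \<partial>(\<Pi>\<^sub>M i\<in>{1..N}. lborel))"
  unfolding weyl_lborel_def
  using sets_weyl weyl_subset_space by (intro nn_integral_restrict_space) (simp add: Int_absorb2)

lemma (in weighted_nodes) in_cells_imp_weyl:
  assumes "0 \<le> z 0" and "z m \<le> 1" and x: "x \<in> extensional {1..m}" "in_cells m z x"
  shows "x \<in> weyl m"
proof -
  have "x i \<le> x j" if ij: "i \<in> {1..m}" "j \<in> {1..m}" "i \<le> j" for i j
  proof (cases "i = j")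
    case False
    then have "z i \<le> z (j - 1)" using ij by (intro le) auto
    moreover have "x i \<le> z i" "z (j - 1) \<le> x j"
      using x ij by (auto simp: in_cells_def)
    ultimately show ?thesis by simp
  qed simp
  moreover have "0 \<le> x i \<and> x i \<le> 1" if "i \<in> {1..m}" for i
    using in_cells_bounds[OF x(2) that] assms by auto
  ultimately show ?thesis
    using x(1) by (auto simp: weyl_def PiE_def mono_on_def)
qed

lemma (in weighted_nodes) nn_integral_dixon_integrand:
  assumes "0 \<le> z 0" and "z m \<le> 1" and "c \<ge> 0"
  shows "(\<integral>\<^sup>+ x. ennreal (c * dixon_integrand m z s (\<lambda>_. 1) x) \<partial>weyl_lborel m) =
    ennreal (c * dixon_integral m z s (\<lambda>_. 1))"
proof -
  have "ennreal (c * dixon_integrand m z s (\<lambda>_. 1) x) * indicator (weyl m) x = ennreal (c * dixon_integrand m z s (\<lambda>_. 1) x)"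
    if "x \<in> space (\<Pi>\<^sub>M i\<in>{1..m}. lborel)" for x
  proof (cases "in_cells m z x")
    case True
    then have "x \<in> weyl m" using that assms by (intro in_cells_imp_weyl) (auto simp: space_PiM PiE_def)
    then show ?thesis by simp
  qed (simp add: dixon_integrand_outside)
  then have "(\<integral>\<^sup>+ x. ennreal (c * dixon_integrand m z s (\<lambda>_. 1) x) \<partial>weyl_lborel m) =
      (\<integral>\<^sup>+ x. ennreal (c * dixon_integrand m z s (\<lambda>_. 1) x) \<partial>(\<Pi>\<^sub>M i\<in>{1..m}. lborel))"
    unfolding nn_integral_weyl_lborel by (intro nn_integral_cong)
  also have "\<dots> = ennreal (\<integral>x. c * dixon_integrand m z s (\<lambda>_. 1) x \<partial>(\<Pi>\<^sub>M i\<in>{1..m}. lborel))"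
    using \<open>c \<ge> 0\<close>
    by (intro nn_integral_eq_integral integrable_mult_right integrable_dixon_1 AE_I2 mult_nonneg_nonneg dixon_integrand_nonneg)
  finally show ?thesis
    by (simp add: dixon_integral_def)
qed

definition anderson_kernel :: "nat \<Rightarrow> real \<Rightarrow> (nat \<Rightarrow> real) \<Rightarrow> (nat \<Rightarrow> real) \<Rightarrow> real" where
  "anderson_kernel n \<theta> x y = dixon_anderson_density n \<theta> x y * indicator (interlacing n x) y"

lemma prod_shift_Suc: "(\<Prod>i=1..n+1. f i) = (\<Prod>i\<le>n. f (Suc i))"
  by (rule prod.reindex_bij_witness[of _ Suc "\<lambda>i. i - 1"]) auto

lemma prod_shift_Suc': "(\<Prod>j\<in>{Suc i<..n+1}. f j) = (\<Prod>j\<in>{i<..n}. f (Suc j))"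
  by (rule prod.reindex_bij_witness[of _ Suc "\<lambda>i. i - 1"]) auto

text \<open>
  As a function of \<open>y\<close> the kernel is a Dixon-Anderson integrand for the nodes \<open>x\<close>.  The coordinates of
  \<open>x\<close> are numbered from 1 and the nodes from 0, whence the shift.
\<close>

lemma anderson_kernel_conv_dixon_integrand:
  assumes x: "x \<in> weyl (n + 1)" and y: "y \<in> weyl n"
  shows "anderson_kernel n \<theta> x y =
    Gamma (\<theta> * real (n + 1)) / Gamma \<theta> ^ (n + 1) *
     (\<Prod>i=1..n+1. \<Prod>j\<in>{i<..n+1}. (x j - x i) powr (1 - 2 * \<theta>)) *
     dixon_integrand n (\<lambda>j. x (Suc j)) (\<lambda>_. \<theta>) (\<lambda>_. 1) y"
proof -
  have int: "y \<in> interlacing n x \<longleftrightarrow> in_cells n (\<lambda>j. x (Suc j)) y"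
    using y by (auto simp: weyl_def interlacing_def in_cells_def)
  show ?thesis
  proof (cases "y \<in> interlacing n x")
    case True
    then have "(\<Prod>i=1..n. cell_weight n (\<lambda>j. x (Suc j)) (\<lambda>_. \<theta>) i (y i)) =
        (\<Prod>i=1..n. \<Prod>j=1..n+1. \<bar>y i - x j\<bar> powr (\<theta> - 1))"
      using int unfolding prod_shift_Suc
      by (intro prod.cong) (auto simp: cell_weight_def node_weight_def in_cells_def)
    then show ?thesis
      using True by (simp add: anderson_kernel_def dixon_anderson_density_def dixon_integrand_def vandermonde_def)
  qed (use int in \<open>auto simp: anderson_kernel_def dixon_integrand_outside\<close>)
qed

lemma nn_integral_anderson_kernel_strict:
  assumes x: "x \<in> weyl (n + 1)" and strict: "strict_mono_on {1..n+1} x" and "\<theta> > 0"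
  shows "(\<integral>\<^sup>+ y. ennreal (anderson_kernel n \<theta> x y) \<partial>weyl_lborel n) = 1"
proof -
  interpret weighted_nodes n "\<lambda>j. x (Suc j)" "\<lambda>_. \<theta>"
    using strict \<open>\<theta> > 0\<close> by unfold_locales (auto simp: strict_mono_on_def)
  let ?V = "\<lambda>e. \<Prod>i\<le>n. \<Prod>j\<in>{i<..n}. (x (Suc j) - x (Suc i)) powr e"
  define G where "G = Gamma (\<theta> * real (n + 1)) / Gamma \<theta> ^ (n + 1)"
  have G: "G > 0" unfolding G_def
    using \<open>\<theta> > 0\<close> by (intro divide_pos_pos zero_less_power Gamma_real_pos mult_pos_pos) auto
  have "(\<integral>\<^sup>+ y. ennreal (anderson_kernel n \<theta> x y) \<partial>weyl_lborel n) =
      (\<integral>\<^sup>+ y. ennreal (G * ?V (1 - 2 * \<theta>) * dixon_integrand n (\<lambda>j. x (Suc j)) (\<lambda>_. \<theta>) (\<lambda>_. 1) y) \<partial>weyl_lborel n)"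
    using x unfolding G_def
    by (intro nn_integral_cong)
      (simp only: anderson_kernel_conv_dixon_integrand prod_shift_Suc prod_shift_Suc' space_weyl_lborel)
  also have "\<dots> = ennreal (G * ?V (1 - 2 * \<theta>) * dixon_integral n (\<lambda>j. x (Suc j)) (\<lambda>_. \<theta>) (\<lambda>_. 1))"
    using x G by (intro nn_integral_dixon_integrand mult_nonneg_nonneg prod_nonneg) (auto simp: weyl_def)
  also have "dixon_integral n (\<lambda>j. x (Suc j)) (\<lambda>_. \<theta>) (\<lambda>_. 1) = inverse G * ?V (2 * \<theta> - 1)"
    using dixon_anderson_integral[OF weighted_nodes_axioms]
    by (simp add: G_def mult.commute[of \<theta>] del: power_Suc of_nat_Suc)
  also have "G * ?V (1 - 2 * \<theta>) * (inverse G * ?V (2 * \<theta> - 1)) = ?V (1 - 2 * \<theta>) * ?V (2 * \<theta> - 1)"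
    using G by simp
  also have "\<dots> = 1"
  proof -
    have "(x (Suc j) - x (Suc i)) powr (1 - 2 * \<theta>) * (x (Suc j) - x (Suc i)) powr (2 * \<theta> - 1) = 1"
      if "i \<in> {..n}" "j \<in> {i<..n}" for i j
      using less[of i j] that by (simp flip: powr_add)
    then show ?thesis
      unfolding prod.distrib[symmetric] by (intro prod.neutral ballI)
  qed
  finally show ?thesis by simp
qed

section \<open>Integrating out the larger configuration\<close>

text \<open>
  The nodes between which \<open>x\<close> is confined when \<open>y\<close> is given: \<open>0, y 1, \<dots>, y n, 1\<close>.
\<close>

definition edge_nodes :: "nat \<Rightarrow> (nat \<Rightarrow> real) \<Rightarrow> nat \<Rightarrow> real" where
  "edge_nodes n y j = (if j = 0 then 0 else if j \<le> n then y j else 1)"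

text \<open>
  The factors \<open>x i powr (\<theta> * p - 1)\<close> and \<open>(1 - x i) powr (\<theta> * q - 1)\<close> of the Jacobi weight play the role of
  the nodes \<open>0\<close> and \<open>1\<close>.
\<close>

definition edge_exponents :: "nat \<Rightarrow> real \<Rightarrow> real \<Rightarrow> real \<Rightarrow> nat \<Rightarrow> real" where
  "edge_exponents n \<theta> p q j = (if j = 0 then \<theta> * p else if j \<le> n then \<theta> else \<theta> * q)"

lemma edge_nodes_simps [simp]:
  "edge_nodes n y 0 = 0" "edge_nodes n y (Suc n) = 1" "j \<in> {1..n} \<Longrightarrow> edge_nodes n y j = y j"
  "edge_exponents n \<theta> p q 0 = \<theta> * p" "edge_exponents n \<theta> p q (Suc n) = \<theta> * q"
  "j \<in> {1..n} \<Longrightarrow> edge_exponents n \<theta> p q j = \<theta>"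
  by (auto simp: edge_nodes_def edge_exponents_def)

lemma atMost_Suc_edges: "{..Suc n} = insert 0 (insert (Suc n) {1..n})"
  by auto

lemma prod_edges: "(\<Prod>j\<le>Suc n. f j) = f 0 * (\<Prod>j=1..n. f j) * (f (Suc n) :: real)"
  unfolding atMost_Suc_edges by simp

lemma in_cells_edge_nodes_iff:
  assumes x: "x \<in> weyl (n + 1)" and y: "y \<in> weyl n"
  shows "in_cells (n + 1) (edge_nodes n y) x \<longleftrightarrow> y \<in> interlacing n x"
proof
  assume *: "in_cells (n + 1) (edge_nodes n y) x"
  have "x i \<le> y i \<and> y i \<le> x (i + 1)" if "i \<in> {1..n}" for i
    using *[unfolded in_cells_def, rule_format, of i] *[unfolded in_cells_def, rule_format, of "i + 1"] that
    by auto
  then show "y \<in> interlacing n x" using y by (auto simp: interlacing_def weyl_def)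
next
  assume *: "y \<in> interlacing n x"
  show "in_cells (n + 1) (edge_nodes n y) x"
    unfolding in_cells_def
  proof (intro ballI conjI)
    fix i assume i: "i \<in> {1..n + 1}"
    have x01: "0 \<le> x i" "x i \<le> 1" using x i by (auto simp: weyl_def)
    show "edge_nodes n y (i - 1) \<le> x i"
    proof (cases "i = 1")
      case False
      then have "i - 1 \<in> {1..n}" using i by auto
      moreover have "y (i - 1) \<le> x (i - 1 + 1)" using * calculation by (auto simp: interlacing_def)
      ultimately show ?thesis using i by simp
    qed (use x01 in simp)
    show "x i \<le> edge_nodes n y i"
    proof (cases "i = n + 1")
      case False
      then have "i \<in> {1..n}" using i by auto
      then show ?thesis using * by (auto simp: interlacing_def)
    qed (use x01 in simp)
  qed
qed

definition joint_const :: "nat \<Rightarrow> real \<Rightarrow> real" where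
  "joint_const n \<theta> = Gamma (\<theta> * real (n + 1)) / Gamma \<theta> ^ (n + 1)"

lemma joint_const_pos: "\<theta> > 0 \<Longrightarrow> joint_const n \<theta> > 0"
  unfolding joint_const_def by (intro divide_pos_pos zero_less_power Gamma_real_pos mult_pos_pos) auto

text \<open>
  The identity holds at every point, including those where coordinates coincide: there both
  \<open>\<bar>x j - x i\<bar> powr \<beta> * (x j - x i) powr (1 - 2 * \<theta>)\<close> and \<open>x j - x i\<close> are zero.
\<close>

lemma jacobi_weight_mult_anderson_kernel:
  assumes x: "x \<in> weyl (n + 1)" and y: "y \<in> weyl n" and "\<theta> = \<beta> / 2"
  shows "jacobi_weight (n + 1) p q \<beta> x * anderson_kernel n \<theta> x y =
    joint_const n \<theta> * vandermonde n y *
    dixon_integrand (n + 1) (edge_nodes n y) (edge_exponents n \<theta> p q) (\<lambda>_. 1) x"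
proof (cases "y \<in> interlacing n x")
  case True
  have in_cells: "in_cells (n + 1) (edge_nodes n y) x"
    using True x y by (simp only: in_cells_edge_nodes_iff)
  let ?w = "\<lambda>i. x i powr (\<theta> * p - 1) * (1 - x i) powr (\<theta> * q - 1)"
  have cell: "cell_weight (n + 1) (edge_nodes n y) (edge_exponents n \<theta> p q) i (x i) =
      ?w i * (\<Prod>j=1..n. \<bar>y j - x i\<bar> powr (\<theta> - 1))" if i: "i \<in> {1..n + 1}" for i
  proof -
    have "0 \<le> x i" "x i \<le> 1" using x i by (auto simp: weyl_def)
    then have "node_weight (n + 1) (edge_nodes n y) (edge_exponents n \<theta> p q) (x i) =
        ?w i * (\<Prod>j=1..n. \<bar>y j - x i\<bar> powr (\<theta> - 1))"
      unfolding node_weight_def Suc_eq_plus1[symmetric] prod_edges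
      by (simp add: abs_minus_commute[of "x i"] mult_ac)
    moreover have "edge_nodes n y (i - 1) \<le> x i \<and> x i \<le> edge_nodes n y i"
      using in_cells i by (auto simp: in_cells_def)
    ultimately show ?thesis by (simp add: cell_weight_def)
  qed
  have "(\<Prod>i=1..n+1. cell_weight (n + 1) (edge_nodes n y) (edge_exponents n \<theta> p q) i (x i)) =
      (\<Prod>i=1..n+1. ?w i * (\<Prod>j=1..n. \<bar>y j - x i\<bar> powr (\<theta> - 1)))"
    by (rule prod.cong[OF refl cell])
  also have "\<dots> = (\<Prod>i=1..n+1. ?w i) * (\<Prod>i=1..n+1. \<Prod>j=1..n. \<bar>y j - x i\<bar> powr (\<theta> - 1))"
    by (rule prod.distrib)
  also have "(\<Prod>i=1..n+1. \<Prod>j=1..n. \<bar>y j - x i\<bar> powr (\<theta> - 1)) =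
      (\<Prod>i=1..n. \<Prod>j=1..n+1. \<bar>y i - x j\<bar> powr (\<theta> - 1))"
    by (rule prod.swap)
  finally have cells: "(\<Prod>i=1..n+1. cell_weight (n + 1) (edge_nodes n y) (edge_exponents n \<theta> p q) i (x i)) =
      (\<Prod>i=1..n+1. ?w i) * (\<Prod>i=1..n. \<Prod>j=1..n+1. \<bar>y i - x j\<bar> powr (\<theta> - 1))" .
  have vdm: "(\<Prod>i=1..n+1. \<Prod>j\<in>{i<..n+1}. \<bar>x j - x i\<bar> powr \<beta>) *
      (\<Prod>i=1..n+1. \<Prod>j\<in>{i<..n+1}. (x j - x i) powr (1 - 2 * \<theta>)) = vandermonde (n + 1) x"
    unfolding vandermonde_def prod.distrib[symmetric]
  proof (intro prod.cong refl)
    fix i j assume "i \<in> {1..n+1}" "j \<in> {i<..n+1}"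
    then have "x i \<le> x j" using x by (auto simp: weyl_def mono_on_def)
    moreover have "\<beta> + (1 - 2 * \<theta>) = 1" using \<open>\<theta> = \<beta> / 2\<close> by simp
    ultimately show "\<bar>x j - x i\<bar> powr \<beta> * (x j - x i) powr (1 - 2 * \<theta>) = x j - x i"
      by (simp only: powr_add[symmetric] abs_of_nonneg diff_ge_0_iff_ge powr_one)
  qed
  have "jacobi_weight (n + 1) p q \<beta> x * anderson_kernel n \<theta> x y =
      joint_const n \<theta> * vandermonde n y *
      (((\<Prod>i=1..n+1. \<Prod>j\<in>{i<..n+1}. \<bar>x j - x i\<bar> powr \<beta>) *
        (\<Prod>i=1..n+1. \<Prod>j\<in>{i<..n+1}. (x j - x i) powr (1 - 2 * \<theta>))) *
       ((\<Prod>i=1..n+1. ?w i) * (\<Prod>i=1..n. \<Prod>j=1..n+1. \<bar>y i - x j\<bar> powr (\<theta> - 1))))"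
    using True
    by (simp only: jacobi_weight_def anderson_kernel_def dixon_anderson_density_def \<open>\<theta> = \<beta> / 2\<close>
        joint_const_def vandermonde_def indicator_simps mult_1_right mult_ac)
  then show ?thesis
    unfolding vdm cells[symmetric] by (simp only: dixon_integrand_def mult_1)
next
  case False
  then have "\<not> in_cells (n + 1) (edge_nodes n y) x"
    using x y by (simp only: in_cells_edge_nodes_iff not_False_eq_True)
  then show ?thesis
    using False by (simp add: anderson_kernel_def dixon_integrand_outside)
qed

text \<open>
  The constant of the kernel times the Gamma quotient of the Dixon-Anderson integral with exponents
  \<open>edge_exponents\<close>.
\<close>

definition intertwining_const :: "nat \<Rightarrow> real \<Rightarrow> real \<Rightarrow> real \<Rightarrow> real" where
  "intertwining_const n \<theta> p q = joint_const n \<theta> *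
     (Gamma (\<theta> * p) * Gamma \<theta> ^ n * Gamma (\<theta> * q) / Gamma (\<theta> * p + real n * \<theta> + \<theta> * q))"

lemma intertwining_const_pos:
  "\<theta> > 0 \<Longrightarrow> p > 0 \<Longrightarrow> q > 0 \<Longrightarrow> intertwining_const n \<theta> p q > 0"
  unfolding intertwining_const_def
  by (intro mult_pos_pos divide_pos_pos zero_less_power joint_const_pos Gamma_real_pos add_pos_pos
      add_pos_nonneg mult_nonneg_nonneg) auto

text \<open>
  The pair of nodes \<open>0\<close> and \<open>y i\<close> contributes the exponent \<open>\<theta> * p + \<theta> - 1 = \<theta> * (p + 1) - 1\<close>, the pair
  \<open>y i\<close> and \<open>1\<close> contributes \<open>\<theta> * (q + 1) - 1\<close>, and two coordinates of \<open>y\<close> contribute \<open>\<beta> - 1\<close>, which the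
  Vandermonde product raises to \<open>\<beta>\<close>.
\<close>

lemma vandermonde_mult_dixon_integral_edge:
  assumes "weighted_nodes (n + 1) (edge_nodes n y) (edge_exponents n \<theta> p q)"
    and y: "y \<in> weyl n" and "\<theta> = \<beta> / 2" and "\<theta> > 0"
  shows "joint_const n \<theta> * vandermonde n y *
      dixon_integral (n + 1) (edge_nodes n y) (edge_exponents n \<theta> p q) (\<lambda>_. 1) =
    intertwining_const n \<theta> p q * jacobi_weight n (p + 1) (q + 1) \<beta> y"
proof -
  let ?z = "edge_nodes n y" and ?s = "edge_exponents n \<theta> p q"
  let ?f = "\<lambda>i j. (?z j - ?z i) powr (?s i + ?s j - 1)"
  have y01: "0 \<le> y i" "y i \<le> 1" if "i \<in> {1..n}" for i
    using y that by (auto simp: weyl_def)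
  have left: "(\<Prod>j\<in>{0<..Suc n}. ?f 0 j) = (\<Prod>i=1..n. y i powr (\<theta> * (p + 1) - 1))"
  proof -
    have "{0<..Suc n} = insert (Suc n) {1..n}" by auto
    then show ?thesis by (simp add: algebra_simps)
  qed
  have mid: "(\<Prod>j\<in>{i<..Suc n}. ?f i j) =
      (1 - y i) powr (\<theta> * (q + 1) - 1) * (\<Prod>j\<in>{i<..n}. (y j - y i) powr (\<beta> - 1))" if "i \<in> {1..n}" for i
  proof -
    have "{i<..Suc n} = insert (Suc n) {i<..n}" using that by auto
    moreover have "(\<Prod>j\<in>{i<..n}. ?f i j) = (\<Prod>j\<in>{i<..n}. (y j - y i) powr (\<beta> - 1))"
      using that \<open>\<theta> = \<beta> / 2\<close> by (intro prod.cong) (auto simp: mult.commute)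
    ultimately show ?thesis using that by (simp add: algebra_simps)
  qed
  let ?P = "\<Prod>i=1..n. y i powr (\<theta> * (p + 1) - 1) * (1 - y i) powr (\<theta> * (q + 1) - 1)"
  let ?Q = "\<Prod>i=1..n. \<Prod>j\<in>{i<..n}. (y j - y i) powr (\<beta> - 1)"
  have nodes: "(\<Prod>i\<le>Suc n. \<Prod>j\<in>{i<..Suc n}. ?f i j) = ?P * ?Q"
    unfolding prod_edges[of "\<lambda>i. \<Prod>j\<in>{i<..Suc n}. ?f i j"] left
    by (simp only: mid prod.distrib cong: prod.cong) simp
  have VQ: "vandermonde n y * ?Q =
      (\<Prod>i=1..n. \<Prod>j\<in>{i<..n}. \<bar>y j - y i\<bar> powr \<beta>)"
    unfolding vandermonde_def prod.distrib[symmetric]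
  proof (intro prod.cong refl)
    fix i j assume "i \<in> {1..n}" "j \<in> {i<..n}"
    then have "y i \<le> y j" using y by (auto simp: weyl_def mono_on_def)
    then show "(y j - y i) * (y j - y i) powr (\<beta> - 1) = \<bar>y j - y i\<bar> powr \<beta>"
      by (cases "y i = y j") (auto simp: powr_diff)
  qed
  have gammas: "(\<Prod>j\<le>Suc n. Gamma (?s j)) = Gamma (\<theta> * p) * Gamma \<theta> ^ n * Gamma (\<theta> * q)"
    unfolding prod_edges by simp
  have exps: "(\<Sum>j\<le>Suc n. ?s j) = \<theta> * p + real n * \<theta> + \<theta> * q"
    unfolding atMost_Suc_edges by simp
  let ?g = "Gamma (\<theta> * p) * Gamma \<theta> ^ n * Gamma (\<theta> * q) / Gamma (\<theta> * p + real n * \<theta> + \<theta> * q)"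
  have "dixon_integral (n + 1) ?z ?s (\<lambda>_. 1) = ?g * (?P * ?Q)"
    using dixon_anderson_integral[OF assms(1)]
    unfolding Suc_eq_plus1[symmetric] nodes gammas exps .
  then have "joint_const n \<theta> * vandermonde n y * dixon_integral (n + 1) ?z ?s (\<lambda>_. 1) =
      joint_const n \<theta> * ?g * (?P * (vandermonde n y * ?Q))"
    by (simp only: mult_ac)
  then show ?thesis
    unfolding VQ intertwining_const_def jacobi_weight_def \<open>\<theta> = \<beta> / 2\<close> .
qed

text \<open>
  For distinct \<open>y i\<close> in the open interval this is the Dixon-Anderson formula.  For all other \<open>y\<close> both
  sides vanish.  If \<open>y i\<close> is \<open>0\<close> or \<open>1\<close>, interlacing forces a coordinate of \<open>x\<close> to the same value, where
  the Jacobi weight is zero because \<open>0 powr e = 0\<close>; if two \<open>y i\<close> coincide, the kernel vanishes.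
\<close>

theorem nn_integral_jacobi_weight_anderson_kernel:
  assumes y: "y \<in> weyl n" and \<theta>: "\<theta> = \<beta> / 2" and "\<beta> > 0" "p > 0" "q > 0"
  shows "(\<integral>\<^sup>+ x. ennreal (jacobi_weight (n + 1) p q \<beta> x * anderson_kernel n \<theta> x y) \<partial>weyl_lborel (n + 1)) =
    ennreal (intertwining_const n \<theta> p q * jacobi_weight n (p + 1) (q + 1) \<beta> y)"
proof -
  let ?z = "edge_nodes n y" and ?s = "edge_exponents n \<theta> p q"
  have y01: "0 \<le> y i" "y i \<le> 1" if "i \<in> {1..n}" for i
    using y that by (auto simp: weyl_def)
  have y_le: "y i \<le> y j" if "i \<in> {1..n}" "j \<in> {i..n}" for i j
    using y that by (auto simp: weyl_def mono_on_def)
  have V: "vandermonde n y \<ge> 0"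
    unfolding vandermonde_def using y_le by (intro prod_nonneg) auto
  consider (edge) i where "i \<in> {1..n}" "y i = 0 \<or> y i = 1"
    | (coincide) i j where "i \<in> {1..n}" "j \<in> {i<..n}" "y i = y j"
    | (generic) "\<And>i. i \<in> {1..n} \<Longrightarrow> y i \<noteq> 0 \<and> y i \<noteq> 1"
        "\<And>i j. i \<in> {1..n} \<Longrightarrow> j \<in> {i<..n} \<Longrightarrow> y i \<noteq> y j"
    by blast
  then show ?thesis
  proof cases
    case edge
    then have "jacobi_weight n (p + 1) (q + 1) \<beta> y = 0"
      by (auto simp: jacobi_weight_def prod_zero_iff)
    moreover have zero: "jacobi_weight (n + 1) p q \<beta> x * anderson_kernel n \<theta> x y = 0" if x: "x \<in> weyl (n + 1)" for x
    proof (cases "y \<in> interlacing n x")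
      case True
      then have "x i \<le> y i" "y i \<le> x (i + 1)" using edge by (auto simp: interlacing_def)
      moreover have "0 \<le> x i" "x (i + 1) \<le> 1" using x edge by (auto simp: weyl_def)
      ultimately have "x i = 0 \<or> x (i + 1) = 1" using edge by auto
      moreover have "i \<in> {1..n + 1}" "i + 1 \<in> {1..n + 1}" using edge by auto
      ultimately obtain k where "k \<in> {1..n + 1}" "x k = 0 \<or> x k = 1" by blast
      then have "(\<Prod>i=1..n+1. x i powr (\<beta> / 2 * p - 1) * (1 - x i) powr (\<beta> / 2 * q - 1)) = 0"
        by (intro prod_zero) auto
      then show ?thesis by (simp only: jacobi_weight_def mult_zero_left)
    qed (simp add: anderson_kernel_def)
    then have "(\<integral>\<^sup>+ x. ennreal (jacobi_weight (n + 1) p q \<beta> x * anderson_kernel n \<theta> x y) \<partial>weyl_lborel (n + 1)) =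
        (\<integral>\<^sup>+ x. 0 \<partial>weyl_lborel (n + 1))"
      by (intro nn_integral_cong) (simp only: space_weyl_lborel ennreal_0)
    ultimately show ?thesis by simp
  next
    case coincide
    have "vandermonde n y = 0" "(\<Prod>i=1..n. \<Prod>j\<in>{i<..n}. \<bar>y j - y i\<bar> powr \<beta>) = 0"
      unfolding vandermonde_def using coincide
      by (intro prod_zero bexI[of _ i] bexI[of _ j]; simp)+
    then have "jacobi_weight n (p + 1) (q + 1) \<beta> y = 0"
      by (simp add: jacobi_weight_def)
    moreover have zero: "jacobi_weight (n + 1) p q \<beta> x * anderson_kernel n \<theta> x y = 0" if "x \<in> weyl (n + 1)" for x
      using jacobi_weight_mult_anderson_kernel[OF that y \<theta>] \<open>vandermonde n y = 0\<close> by simp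
    then have "(\<integral>\<^sup>+ x. ennreal (jacobi_weight (n + 1) p q \<beta> x * anderson_kernel n \<theta> x y) \<partial>weyl_lborel (n + 1)) =
        (\<integral>\<^sup>+ x. 0 \<partial>weyl_lborel (n + 1))"
      by (intro nn_integral_cong) (simp only: space_weyl_lborel ennreal_0)
    ultimately show ?thesis by simp
  next
    case generic
    have nodes: "weighted_nodes (n + 1) ?z ?s"
    proof
      show "strict_mono_on {..n + 1} ?z"
      proof (rule strict_mono_onI)
        fix i j assume ij: "i \<in> {..n + 1}" "j \<in> {..n + 1}" "i < j"
        have gt: "0 < y k" "y k < 1" if "k \<in> {1..n}" for k
          using generic(1)[OF that] y01[OF that] by auto
        show "?z i < ?z j"
          using ij gt[of i] gt[of j] generic(2)[of i j] y_le[of i j] by (auto simp: edge_nodes_def)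
      qed
    qed (use assms in \<open>auto simp: edge_exponents_def\<close>)
    interpret weighted_nodes "n + 1" ?z ?s by (fact nodes)
    have "(\<integral>\<^sup>+ x. ennreal (jacobi_weight (n + 1) p q \<beta> x * anderson_kernel n \<theta> x y) \<partial>weyl_lborel (n + 1)) =
        (\<integral>\<^sup>+ x. ennreal (joint_const n \<theta> * vandermonde n y * dixon_integrand (n + 1) ?z ?s (\<lambda>_. 1) x) \<partial>weyl_lborel (n + 1))"
      using y \<theta> by (intro nn_integral_cong) (simp only: jacobi_weight_mult_anderson_kernel space_weyl_lborel)
    also have "\<dots> = ennreal (joint_const n \<theta> * vandermonde n y * dixon_integral (n + 1) ?z ?s (\<lambda>_. 1))"
      using V joint_const_pos[of \<theta> n] \<theta> \<open>\<beta> > 0\<close>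
      by (intro nn_integral_dixon_integrand) (auto simp: less_imp_le)
    also have "joint_const n \<theta> * vandermonde n y * dixon_integral (n + 1) ?z ?s (\<lambda>_. 1) =
        intertwining_const n \<theta> p q * jacobi_weight n (p + 1) (q + 1) \<beta> y"
      using nodes y \<theta> \<open>\<beta> > 0\<close> by (intro vandermonde_mult_dixon_integral_edge) auto
    finally show ?thesis .
  qed
qed

section \<open>The intertwining of the Jacobi ensembles\<close>

lemma borel_measurable_anderson_kernel:
  "(\<lambda>w. anderson_kernel n \<theta> (fst w) (snd w)) \<in> borel_measurable (weyl_lborel (n + 1) \<Otimes>\<^sub>M weyl_lborel n)"
proof -
  let ?P = "weyl_lborel (n + 1) \<Otimes>\<^sub>M weyl_lborel n"
  have fst: "(\<lambda>w. fst w i) \<in> borel_measurable ?P" if "i \<in> {1..n+1}" for i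
    using measurable_fst borel_measurable_weyl_component[OF that] by (rule measurable_compose)
  have snd: "(\<lambda>w. snd w i) \<in> borel_measurable ?P" if "i \<in> {1..n}" for i
    using measurable_snd borel_measurable_weyl_component[OF that] by (rule measurable_compose)
  have dens: "(\<lambda>w. dixon_anderson_density n \<theta> (fst w) (snd w)) \<in> borel_measurable ?P"
    unfolding dixon_anderson_density_def
    by (intro borel_measurable_times borel_measurable_prod powr_real_measurable borel_measurable_diff
        borel_measurable_abs borel_measurable_const fst snd) auto
  let ?A = "{w \<in> space ?P. \<forall>i\<in>{1..n}. fst w i \<le> snd w i \<and> snd w i \<le> fst w (i + 1)}"
  have "?A \<in> sets ?P"
    by (intro sets.sets_Collect_finite_All sets.sets_Collect_conj borel_measurable_le fst snd) auto
  then have "(\<lambda>w. dixon_anderson_density n \<theta> (fst w) (snd w) * indicator ?A w) \<in> borel_measurable ?P"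
    by (intro borel_measurable_times borel_measurable_indicator dens)
  also have "?this \<longleftrightarrow> ?thesis"
    unfolding anderson_kernel_def
    by (intro measurable_cong) (auto simp: space_pair_measure interlacing_def weyl_def indicator_def)
  finally show ?thesis .
qed

lemma weyl_nonempty: "weyl N \<noteq> {}"
proof -
  have "(\<lambda>i\<in>{1..N}. 0) \<in> weyl N" by (auto simp: weyl_def mono_on_def)
  then show ?thesis by blast
qed

lemma borel_measurable_anderson_kernel_snd:
  assumes "x \<in> weyl (n + 1)"
  shows "anderson_kernel n \<theta> x \<in> borel_measurable (weyl_lborel n)"
  using measurable_compose[OF measurable_Pair1'[of x "weyl_lborel (n + 1)" "weyl_lborel n"] borel_measurable_anderson_kernel] assms
  by simp

lemma dixon_anderson_eq_density:
  assumes "x \<in> weyl (n + 1)"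
  shows "dixon_anderson n \<theta> x = density (weyl_lborel n) (\<lambda>y. ennreal (anderson_kernel n \<theta> x y))"
  unfolding dixon_anderson_def anderson_kernel_def
  by (intro arg_cong[where f = "density _"] ext) (auto simp: indicator_def)

lemma emeasure_dixon_anderson:
  assumes x: "x \<in> weyl (n + 1)" and X: "X \<in> sets (weyl_lborel n)"
  shows "emeasure (dixon_anderson n \<theta> x) X =
    (\<integral>\<^sup>+ y. ennreal (anderson_kernel n \<theta> x y) * indicator X y \<partial>weyl_lborel n)"
  unfolding dixon_anderson_eq_density[OF x]
  using borel_measurable_anderson_kernel_snd[OF x] X by (intro emeasure_density) auto

lemma emeasure_dixon_anderson_weyl:
  assumes x: "x \<in> weyl (n + 1)"
  shows "emeasure (dixon_anderson n \<theta> x) (weyl n) =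
    (\<integral>\<^sup>+ y. ennreal (anderson_kernel n \<theta> x y) \<partial>weyl_lborel n)"
  using sets.top[of "weyl_lborel n"]
  by (subst emeasure_dixon_anderson[OF x]) (auto intro!: nn_integral_cong)

lemma weyl_strict_or_coincide:
  assumes x: "x \<in> weyl N"
  obtains "strict_mono_on {1..N} x" | i j where "i \<in> {1..N}" "j \<in> {i<..N}" "x i = x j"
proof (cases "\<exists>i\<in>{1..N}. \<exists>j\<in>{i<..N}. x i = x j")
  case False
  have "strict_mono_on {1..N} x"
  proof (rule strict_mono_onI)
    fix i j assume ij: "i \<in> {1..N}" "j \<in> {1..N}" "i < j"
    then have "x i \<le> x j" using x by (auto simp: weyl_def mono_on_def)
    then show "x i < x j" using False ij by (auto simp: less_le)
  qed
  then show thesis by (rule that(1))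
qed (use that in blast)

lemma anderson_kernel_coincide:
  assumes "i \<in> {1..n + 1}" "j \<in> {i<..n + 1}" "x i = x j"
  shows "anderson_kernel n \<theta> x y = 0"
proof -
  have "(\<Prod>i=1..n+1. \<Prod>j\<in>{i<..n+1}. (x j - x i) powr (1 - 2 * \<theta>)) = 0"
    using assms by (intro prod_zero bexI[of _ i] bexI[of _ j]) auto
  then show ?thesis
    by (simp only: anderson_kernel_def dixon_anderson_density_def mult_zero_left mult_zero_right)
qed

lemma measurable_dixon_anderson:
  assumes "\<theta> > 0"
  shows "dixon_anderson n \<theta> \<in> weyl_lborel (n + 1) \<rightarrow>\<^sub>M subprob_algebra (weyl_lborel n)"
proof (rule measurable_subprob_algebra)
  fix x assume "x \<in> space (weyl_lborel (n + 1))"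
  then have x: "x \<in> weyl (n + 1)" by simp
  have "(\<integral>\<^sup>+ y. ennreal (anderson_kernel n \<theta> x y) \<partial>weyl_lborel n) \<le> 1"
    using x
  proof (cases rule: weyl_strict_or_coincide)
    case 1
    then show ?thesis using nn_integral_anderson_kernel_strict[OF x] assms by simp
  next
    case (2 i j)
    then show ?thesis by (simp add: anderson_kernel_coincide[OF 2])
  qed
  then show "subprob_space (dixon_anderson n \<theta> x)"
    using weyl_nonempty emeasure_dixon_anderson_weyl[OF x, of \<theta>]
    by (intro subprob_spaceI) (simp_all add: dixon_anderson_def)
  show "sets (dixon_anderson n \<theta> x) = sets (weyl_lborel n)"
    by (simp add: dixon_anderson_def)
next
  fix X assume X: "X \<in> sets (weyl_lborel n)"
  interpret sigma_finite_measure "weyl_lborel n" by (rule sigma_finite_weyl_lborel)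
  have "(\<lambda>x. \<integral>\<^sup>+ y. ennreal (anderson_kernel n \<theta> x y) * indicator X y \<partial>weyl_lborel n)
      \<in> borel_measurable (weyl_lborel (n + 1))"
    using borel_measurable_anderson_kernel[of n \<theta>] X
    by (intro borel_measurable_nn_integral) (simp add: case_prod_beta')
  also have "?this \<longleftrightarrow> (\<lambda>x. emeasure (dixon_anderson n \<theta> x) X) \<in> borel_measurable (weyl_lborel (n + 1))"
    using X by (intro measurable_cong) (simp add: emeasure_dixon_anderson)
  finally show "(\<lambda>x. emeasure (dixon_anderson n \<theta> x) X) \<in> borel_measurable (weyl_lborel (n + 1))" .
qed

text \<open>
  The unnormalized form of the intertwining, by Tonelli's theorem.
\<close>

theorem nn_integral_jacobi_weight_dixon_anderson:
  assumes X: "X \<in> sets (weyl_lborel n)" and \<theta>: "\<theta> = \<beta> / 2" and pos: "\<beta> > 0" "p > 0" "q > 0"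
  shows "(\<integral>\<^sup>+ x. ennreal (jacobi_weight (n + 1) p q \<beta> x) * emeasure (dixon_anderson n \<theta> x) X \<partial>weyl_lborel (n + 1)) =
    ennreal (intertwining_const n \<theta> p q) *
      (\<integral>\<^sup>+ y. ennreal (jacobi_weight n (p + 1) (q + 1) \<beta> y) * indicator X y \<partial>weyl_lborel n)"
proof -
  let ?M = "weyl_lborel (n + 1)" and ?N = "weyl_lborel n"
  let ?w = "jacobi_weight (n + 1) p q \<beta>" and ?k = "anderson_kernel n \<theta>"
  interpret M: sigma_finite_measure ?M by (rule sigma_finite_weyl_lborel)
  interpret N: sigma_finite_measure ?N by (rule sigma_finite_weyl_lborel)
  interpret pair_sigma_finite ?M ?N ..
  note [measurable] = X borel_measurable_anderson_kernel[of n \<theta>]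
  have k [measurable]: "?k x \<in> borel_measurable ?N" if "x \<in> weyl (n + 1)" for x
    using that by (rule borel_measurable_anderson_kernel_snd)
  have "(\<integral>\<^sup>+ x. ennreal (?w x) * emeasure (dixon_anderson n \<theta> x) X \<partial>?M) =
      (\<integral>\<^sup>+ x. \<integral>\<^sup>+ y. ennreal (?w x * ?k x y) * indicator X y \<partial>?N \<partial>?M)"
  proof (rule nn_integral_cong)
    fix x assume "x \<in> space ?M"
    then have x: "x \<in> weyl (n + 1)" by simp
    note [measurable] = k[OF x]
    have "ennreal (?w x) * emeasure (dixon_anderson n \<theta> x) X =
        (\<integral>\<^sup>+ y. ennreal (?w x) * (ennreal (?k x y) * indicator X y) \<partial>?N)"
      unfolding emeasure_dixon_anderson[OF x X] by (rule nn_integral_cmult[symmetric]) measurable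
    then show "ennreal (?w x) * emeasure (dixon_anderson n \<theta> x) X =
        (\<integral>\<^sup>+ y. ennreal (?w x * ?k x y) * indicator X y \<partial>?N)"
      by (simp add: ennreal_mult' jacobi_weight_nonneg mult.assoc)
  qed
  also have "\<dots> = (\<integral>\<^sup>+ y. \<integral>\<^sup>+ x. ennreal (?w x * ?k x y) * indicator X y \<partial>?M \<partial>?N)"
  proof (rule Fubini'[symmetric])
    have "(\<lambda>w. ennreal (?w (fst w) * ?k (fst w) (snd w)) * indicator X (snd w)) \<in> borel_measurable (?M \<Otimes>\<^sub>M ?N)"
      by measurable
    then show "case_prod (\<lambda>x y. ennreal (?w x * ?k x y) * indicator X y) \<in> borel_measurable (?M \<Otimes>\<^sub>M ?N)"
      by (simp add: case_prod_beta')
  qed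
  also have "\<dots> = (\<integral>\<^sup>+ y. ennreal (intertwining_const n \<theta> p q) *
      (ennreal (jacobi_weight n (p + 1) (q + 1) \<beta> y) * indicator X y) \<partial>?N)"
  proof (rule nn_integral_cong)
    fix y assume "y \<in> space ?N"
    then have y: "y \<in> weyl n" by simp
    have "(\<lambda>x. ?k x y) \<in> borel_measurable ?M"
      using measurable_compose[OF measurable_Pair2'[of y "weyl_lborel n" "weyl_lborel (n + 1)"] borel_measurable_anderson_kernel] y by simp
    then have "(\<integral>\<^sup>+ x. ennreal (?w x * ?k x y) * indicator X y \<partial>?M) =
        (\<integral>\<^sup>+ x. ennreal (?w x * ?k x y) \<partial>?M) * indicator X y"
      by (intro nn_integral_multc) measurable
    also have "(\<integral>\<^sup>+ x. ennreal (?w x * ?k x y) \<partial>?M) =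
        ennreal (intertwining_const n \<theta> p q) * ennreal (jacobi_weight n (p + 1) (q + 1) \<beta> y)"
      unfolding nn_integral_jacobi_weight_anderson_kernel[OF y \<theta> pos]
      by (intro ennreal_mult' less_imp_le intertwining_const_pos) (use \<theta> pos in auto)
    finally show "(\<integral>\<^sup>+ x. ennreal (?w x * ?k x y) * indicator X y \<partial>?M) =
        ennreal (intertwining_const n \<theta> p q) * (ennreal (jacobi_weight n (p + 1) (q + 1) \<beta> y) * indicator X y)"
      by (simp add: mult.assoc)
  qed
  also have "\<dots> = ennreal (intertwining_const n \<theta> p q) *
      (\<integral>\<^sup>+ y. ennreal (jacobi_weight n (p + 1) (q + 1) \<beta> y) * indicator X y \<partial>?N)"
    by (rule nn_integral_cmult) measurable
  finally show ?thesis .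
qed

text \<open>
  The unnormalized intertwining applied to the whole space, where the kernel has mass one.  If two
  coordinates of \<open>x\<close> coincide, the kernel is the null measure, but then the Jacobi weight is zero as
  well.
\<close>

lemma jacobi_const_Suc:
  assumes "\<beta> > 0" "p > 0" "q > 0"
  shows "jacobi_const (n + 1) p q \<beta> =
    ennreal (intertwining_const n (\<beta> / 2) p q) * jacobi_const n (p + 1) (q + 1) \<beta>"
proof -
  have "jacobi_const (n + 1) p q \<beta> = (\<integral>\<^sup>+ x. ennreal (jacobi_weight (n + 1) p q \<beta> x) *
      emeasure (dixon_anderson n (\<beta> / 2) x) (weyl n) \<partial>weyl_lborel (n + 1))"
    unfolding jacobi_const_def
  proof (rule nn_integral_cong)
    fix x assume "x \<in> space (weyl_lborel (n + 1))"
    then have x: "x \<in> weyl (n + 1)" by simp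
    then show "ennreal (jacobi_weight (n + 1) p q \<beta> x) =
        ennreal (jacobi_weight (n + 1) p q \<beta> x) * emeasure (dixon_anderson n (\<beta> / 2) x) (weyl n)"
    proof (cases rule: weyl_strict_or_coincide)
      case 1
      have "emeasure (dixon_anderson n (\<beta> / 2) x) (weyl n) =
          (\<integral>\<^sup>+ y. ennreal (anderson_kernel n (\<beta> / 2) x y) \<partial>weyl_lborel n)"
        using x by (rule emeasure_dixon_anderson_weyl)
      also have "\<dots> = 1" using assms by (intro nn_integral_anderson_kernel_strict x 1) auto
      finally show ?thesis by simp
    next
      case (2 i j)
      have "(\<Prod>i=1..n+1. \<Prod>j\<in>{i<..n+1}. \<bar>x j - x i\<bar> powr \<beta>) = 0"
        using 2 by (intro prod_zero bexI[of _ i] bexI[of _ j]) auto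
      then have "jacobi_weight (n + 1) p q \<beta> x = 0"
        by (simp only: jacobi_weight_def mult_zero_right)
      then show ?thesis by simp
    qed
  qed
  also have "\<dots> = ennreal (intertwining_const n (\<beta> / 2) p q) *
      (\<integral>\<^sup>+ y. ennreal (jacobi_weight n (p + 1) (q + 1) \<beta> y) * indicator (weyl n) y \<partial>weyl_lborel n)"
    using assms sets.top[of "weyl_lborel n"] by (intro nn_integral_jacobi_weight_dixon_anderson) auto
  also have "(\<integral>\<^sup>+ y. ennreal (jacobi_weight n (p + 1) (q + 1) \<beta> y) * indicator (weyl n) y \<partial>weyl_lborel n) =
      jacobi_const n (p + 1) (q + 1) \<beta>"
    unfolding jacobi_const_def by (intro nn_integral_cong) auto
  finally show ?thesis .
qed

text \<open>
  The factor \<open>K\<close> from the unnormalized intertwining also relates the two normalization constants and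
  cancels.
\<close>

theorem corollary1p4:
  fixes n :: nat and \<beta> a b :: real
  assumes "n \<ge> 1" and "\<beta> \<ge> 1" and "a > 1" and "b > 1"
  shows "jacobi_ensemble (n + 1) (a - 1) (b - 1) \<beta> \<bind> dixon_anderson n (\<beta> / 2) =
         jacobi_ensemble n a b \<beta>"
proof (rule measure_eqI)
  let ?M = "weyl_lborel (n + 1)" and ?N = "weyl_lborel n"
  let ?J = "jacobi_ensemble (n + 1) (a - 1) (b - 1) \<beta>"
  let ?w = "jacobi_weight (n + 1) (a - 1) (b - 1) \<beta>" and ?v = "jacobi_weight n a b \<beta>"
  let ?A = "jacobi_const (n + 1) (a - 1) (b - 1) \<beta>" and ?C = "jacobi_const n a b \<beta>"
  define K where "K = intertwining_const n (\<beta> / 2) (a - 1) (b - 1)"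
  have K: "K > 0" unfolding K_def using assms by (intro intertwining_const_pos) auto
  have A: "?A = ennreal K * ?C"
    using jacobi_const_Suc[of \<beta> "a - 1" "b - 1" n] assms by (simp add: K_def)
  have kernel: "dixon_anderson n (\<beta> / 2) \<in> ?J \<rightarrow>\<^sub>M subprob_algebra ?N"
    using measurable_dixon_anderson[of "\<beta> / 2" n] assms by (simp add: jacobi_ensemble_def)
  have ne: "space ?J \<noteq> {}"
    by (simp add: jacobi_ensemble_def weyl_nonempty)
  show sets_eq: "sets (?J \<bind> dixon_anderson n (\<beta> / 2)) = sets (jacobi_ensemble n a b \<beta>)"
    using sets_bind_measurable[OF kernel ne] by (simp add: jacobi_ensemble_def)
  fix X assume "X \<in> sets (?J \<bind> dixon_anderson n (\<beta> / 2))"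
  then have X [measurable]: "X \<in> sets ?N"
    using sets_eq by (simp add: jacobi_ensemble_def)
  have meas [measurable]: "(\<lambda>x. emeasure (dixon_anderson n (\<beta> / 2) x) X) \<in> borel_measurable ?M"
    using measurable_compose[OF measurable_dixon_anderson measurable_emeasure_subprob_algebra[OF X]] assms by simp
  have "emeasure (?J \<bind> dixon_anderson n (\<beta> / 2)) X = (\<integral>\<^sup>+ x. emeasure (dixon_anderson n (\<beta> / 2) x) X \<partial>?J)"
    by (rule emeasure_bind[OF ne kernel X])
  also have "\<dots> = (\<integral>\<^sup>+ x. (ennreal (?w x) / ?A) * emeasure (dixon_anderson n (\<beta> / 2) x) X \<partial>?M)"
    unfolding jacobi_ensemble_def by (rule nn_integral_density) measurable
  also have "\<dots> = (\<integral>\<^sup>+ x. (ennreal (?w x) * emeasure (dixon_anderson n (\<beta> / 2) x) X) / ?A \<partial>?M)"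
    by (simp add: divide_ennreal_def mult_ac)
  also have "\<dots> = (\<integral>\<^sup>+ x. ennreal (?w x) * emeasure (dixon_anderson n (\<beta> / 2) x) X \<partial>?M) / ?A"
    by (rule nn_integral_divide) measurable
  also have "(\<integral>\<^sup>+ x. ennreal (?w x) * emeasure (dixon_anderson n (\<beta> / 2) x) X \<partial>?M) =
      (\<integral>\<^sup>+ y. ennreal (?v y) * indicator X y \<partial>?N) * ennreal K"
    using nn_integral_jacobi_weight_dixon_anderson[OF X refl, of \<beta> "a - 1" "b - 1"] assms
    by (simp add: K_def mult.commute)
  also have "?A = ?C * ennreal K"
    by (simp only: A mult.commute)
  also have "(\<integral>\<^sup>+ y. ennreal (?v y) * indicator X y \<partial>?N) * ennreal K / (?C * ennreal K) =
      (\<integral>\<^sup>+ y. ennreal (?v y) * indicator X y \<partial>?N) / ?C"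
    using K by (intro divide_mult_eq) auto
  also have "\<dots> = (\<integral>\<^sup>+ y. (ennreal (?v y) * indicator X y) / ?C \<partial>?N)"
    by (rule nn_integral_divide[symmetric]) measurable
  also have "\<dots> = (\<integral>\<^sup>+ y. (ennreal (?v y) / ?C) * indicator X y \<partial>?N)"
    by (simp add: divide_ennreal_def mult_ac)
  also have "\<dots> = emeasure (jacobi_ensemble n a b \<beta>) X"
    unfolding jacobi_ensemble_def by (rule emeasure_density[symmetric]) measurable
  finally show "emeasure (?J \<bind> dixon_anderson n (\<beta> / 2)) X = emeasure (jacobi_ensemble n a b \<beta>) X" .
qed

end
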